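(* Let $X$ be a countably infinite set and $\mathcal{P} = \{\Sigma_0, \dots, \Sigma_{n-1}\}$ a finite partition of $X$ into $n \geq 2$ parts such that $|\Sigma_i| = |X|$ for all $i \in n$. Then the maximal subsemigroups of $I_X$ which contain $\operatorname{Stab}(\mathcal{P})$ but not $\operatorname{Sym}(X)$ are exactly the following two: $$A_{\mathcal{P}} = \{ f \in I_X \mid \rho_f \in \operatorname{Sym}(n) \text{ or } \operatorname{dom}(\rho_f) \neq n \},$$ $$A_{\mathcal{P}}^{-1} = \{ f \in I_X \mid \rho_f \in \operatorname{Sym}(n) \text{ or } \operatorname{im}(\rho_f) \neq n \}.$$
   Context: For a set $X$, $I_X$ is the symmetric inverse monoid: the set of all bijections between subsets of $X$ (partial bijections, called charts) under composition of partial functions, written left to right (the image of $x$ under $f$ is $xf$). For $\Sigma \subseteq X$, $\Sigma f = \{ xf \mid x \in \Sigma \cap \operatorname{dom}(f)\}$. $\operatorname{Sym}(X) \subseteq I_X$ is the group of all permutations of $X$. A natural number $n$ is identified with $\{0,1,\dots,n-1\}$. $\operatorname{Stab}(\mathcal{P}) = \{ f \in \operatorname{Sym}(X) \mid (\forall i \in n)(\exists j \in n)\ \Sigma_i f = \Sigma_j \}$. For $f \in I_X$, $\rho_f = \{ (i,j) \in n \times n \mid |\Sigma_i f \cap \Sigma_j| = |X| \}$, a binary relation on $n$; $\operatorname{dom}(\rho_f)=\{i : \exists j\,(i,j)\in\rho_f\}$, $\operatorname{im}(\rho_f)=\{j : \exists i\,(i,j)\in\rho_f\}$, and $\rho_f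 \in \operatorname{Sym}(n)$ means that $\rho_f$ is (the graph of) a permutation of $n$. A maximal subsemigroup of $I_X$ is a proper subsemigroup that is maximal under containment among the proper subsemigroups of $I_X$. *)

theory Defs
  imports
    "HOL-Algebra.Group"
    "HOL-Combinatorics.Permutations"
    "HOL-Library.Disjoint_Sets"
    "HOL-Library.Equipollence"
begin

definition charts :: "'a set \<Rightarrow> ('a \<rightharpoonup> 'a) set" where
  "charts X = {f. dom f \<subseteq> X \<and> ran f \<subseteq> X \<and> inj_on f (dom f)}"

(* Charts are composed from left to right: the product f g is "first f, then g". *)
definition sym_inv_monoid :: "'a set \<Rightarrow> ('a \<rightharpoonup> 'a) monoid" where
  "sym_inv_monoid X =
     \<lparr>carrier = charts X, monoid.mult = (\<lambda>f g. g \<circ>\<^sub>m f), one = Some |` X\<rparr>"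

definition sym_perms :: "'a set \<Rightarrow> ('a \<rightharpoonup> 'a) set" where
  "sym_perms X = {f \<in> charts X. dom f = X \<and> ran f = X}"

definition chart_image :: "('a \<rightharpoonup> 'a) \<Rightarrow> 'a set \<Rightarrow> 'a set" where
  "chart_image f S = (\<lambda>x. the (f x)) ` (S \<inter> dom f)"

definition subsemigroup :: "'a set \<Rightarrow> ('a, 'b) monoid_scheme \<Rightarrow> bool" where
  "subsemigroup S G \<longleftrightarrow>
     S \<subseteq> carrier G \<and> (\<forall>x\<in>S. \<forall>y\<in>S. x \<otimes>\<^bsub>G\<^esub> y \<in> S)"

definition maximal_subsemigroup :: "'a set \<Rightarrow> ('a, 'b) monoid_scheme \<Rightarrow> bool" where
  "maximal_subsemigroup S G \<longleftrightarrow>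
     subsemigroup S G \<and> S \<noteq> carrier G \<and>
     (\<forall>T. subsemigroup T G \<and> T \<noteq> carrier G \<and> S \<subseteq> T \<longrightarrow> T = S)"

(* In the following, the finite partition is given by its enumerated parts \<Sigma> 0, ..., \<Sigma> (n - 1);
   values of \<Sigma> at arguments \<ge> n play no role. *)

definition indexed_partition :: "'a set \<Rightarrow> nat \<Rightarrow> (nat \<Rightarrow> 'a set) \<Rightarrow> bool" where
  "indexed_partition X n \<Sigma> \<longleftrightarrow> partition_on X (\<Sigma> ` {..<n}) \<and> inj_on \<Sigma> {..<n}"

definition Stab :: "'a set \<Rightarrow> nat \<Rightarrow> (nat \<Rightarrow> 'a set) \<Rightarrow> ('a \<rightharpoonup> 'a) set" where
  "Stab X n \<Sigma> = {f \<in> sym_perms X. \<forall>i<n. \<exists>j<n. chart_image f (\<Sigma> i) = \<Sigma> j}"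

definition rho :: "'a set \<Rightarrow> nat \<Rightarrow> (nat \<Rightarrow> 'a set) \<Rightarrow> ('a \<rightharpoonup> 'a) \<Rightarrow> (nat \<times> nat) set" where
  "rho X n \<Sigma> f = {(i, j). i < n \<and> j < n \<and> chart_image f (\<Sigma> i) \<inter> \<Sigma> j \<approx> X}"

definition perm_graph :: "nat \<Rightarrow> (nat \<times> nat) set \<Rightarrow> bool" where
  "perm_graph n r \<longleftrightarrow> (\<exists>p. p permutes {..<n} \<and> r = {(i, p i) | i. i < n})"

definition A_part :: "'a set \<Rightarrow> nat \<Rightarrow> (nat \<Rightarrow> 'a set) \<Rightarrow> ('a \<rightharpoonup> 'a) set" where
  "A_part X n \<Sigma> =
     {f \<in> charts X. perm_graph n (rho X n \<Sigma> f) \<or> Domain (rho X n \<Sigma> f) \<noteq> {..<n}}"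

definition A_part_inv :: "'a set \<Rightarrow> nat \<Rightarrow> (nat \<Rightarrow> 'a set) \<Rightarrow> ('a \<rightharpoonup> 'a) set" where
  "A_part_inv X n \<Sigma> =
     {f \<in> charts X. perm_graph n (rho X n \<Sigma> f) \<or> Range (rho X n \<Sigma> f) \<noteq> {..<n}}"

lemma monoid_sym_inv_monoid: "monoid (sym_inv_monoid X)"
proof (rule monoidI)
  fix f g assume "f \<in> carrier (sym_inv_monoid X)" "g \<in> carrier (sym_inv_monoid X)"
  then have f: "dom f \<subseteq> X" "inj_on f (dom f)" and g: "ran g \<subseteq> X" "inj_on g (dom g)"
    by (auto simp: sym_inv_monoid_def charts_def)
  have "dom (g \<circ>\<^sub>m f) \<subseteq> X" "ran (g \<circ>\<^sub>m f) \<subseteq> X"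
    using f(1) g(1) by (auto simp: map_comp_def ran_def split: option.splits)
  moreover have "inj_on (g \<circ>\<^sub>m f) (dom (g \<circ>\<^sub>m f))"
  proof (rule inj_onI)
    fix x y assume xy: "x \<in> dom (g \<circ>\<^sub>m f)" "y \<in> dom (g \<circ>\<^sub>m f)" "(g \<circ>\<^sub>m f) x = (g \<circ>\<^sub>m f) y"
    then obtain a b c where abc: "f x = Some a" "f y = Some b" "g a = Some c" "g b = Some c"
      by (auto simp: map_comp_def split: option.splits)
    then have "a = b" using inj_onD[OF g(2), of a b] by auto
    with abc show "x = y" using inj_onD[OF f(2), of x y] by auto
  qed
  ultimately show "f \<otimes>\<^bsub>sym_inv_monoid X\<^esub> g \<in> carrier (sym_inv_monoid X)"
    by (simp add: sym_inv_monoid_def charts_def)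
next
  show "\<one>\<^bsub>sym_inv_monoid X\<^esub> \<in> carrier (sym_inv_monoid X)"
    by (auto simp: sym_inv_monoid_def charts_def ran_def restrict_map_def inj_on_def
        split: if_splits)
next
  fix f g h
  show "f \<otimes>\<^bsub>sym_inv_monoid X\<^esub> g \<otimes>\<^bsub>sym_inv_monoid X\<^esub> h
      = f \<otimes>\<^bsub>sym_inv_monoid X\<^esub> (g \<otimes>\<^bsub>sym_inv_monoid X\<^esub> h)"
    by (auto simp: sym_inv_monoid_def map_comp_def fun_eq_iff split: option.splits)
next
  fix f assume "f \<in> carrier (sym_inv_monoid X)"
  then have f: "dom f \<subseteq> X" "ran f \<subseteq> X"
    by (auto simp: sym_inv_monoid_def charts_def)
  show "\<one>\<^bsub>sym_inv_monoid X\<^esub> \<otimes>\<^bsub>sym_inv_monoid X\<^esub> f = f"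
  proof -
    have "f x = None" if "x \<notin> X" for x
      using f(1) that by (auto simp: dom_def)
    then show ?thesis
      by (auto simp: sym_inv_monoid_def map_comp_def restrict_map_def fun_eq_iff)
  qed
  show "f \<otimes>\<^bsub>sym_inv_monoid X\<^esub> \<one>\<^bsub>sym_inv_monoid X\<^esub> = f"
    using f(2) by (auto simp: sym_inv_monoid_def map_comp_def restrict_map_def fun_eq_iff ran_def
        split: option.splits)
qed

end

theory Submission
  imports Defs
begin

text \<open>
  Call a chart sparse if its domain and its range both have infinite complement in every part.
  Let \<open>T\<close> be a subsemigroup containing the stabiliser of the partition. If \<open>T\<close> has a total element
  with infinite co-range, interleaving it with stabiliser elements spreads the missing points over
  all parts. If \<open>f\<close> in \<open>T\<close> lies outside \<open>A_part\<close>, then \<open>rho f\<close> is a total relation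
  that is not a permutation, so it relates two indices to a common one; by repeated composition one
  obtains \<open>h\<close> in \<open>T\<close> whose relation sends all indices to a single \<open>q\<close>, and \<open>h\<close> can be given a
  co-range that is infinite in every part. Inversion of charts yields the dual facts, in particular
  some \<open>g\<close> in \<open>T\<close> whose relation sends a single \<open>r\<close> to all indices. Every sparse chart is then of the
  form \<open>a h b g c\<close> with \<open>a\<close>, \<open>b\<close>, \<open>c\<close> in the stabiliser, and every chart \<open>\<phi>\<close> is
  \<open>x (x\<inverse> \<phi> y\<inverse>) y\<close> with \<open>x\<close> total, \<open>y\<close> onto and a sparse middle factor, so \<open>T\<close> is everything.
  A maximal subsemigroup not containing all permutations does have a total element
  with infinite co-range, because it is contained in neither of two proper subsemigroups that
  contain all permutations.
\<close>

section \<open>Distinct representatives for countable families of infinite sets\<close>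

text \<open>Greedy choice along the enumeration \<open>to_nat_on I\<close>: only finitely many
  indices come before \<open>i\<close>, so the infinite set \<open>B i\<close> still contains a
  fresh point.\<close>

lemma infinite_distinct_choice:
  assumes "countable I" and "\<And>i. i \<in> I \<Longrightarrow> infinite (B i)"
  obtains b where "inj_on b I" and "\<And>i. i \<in> I \<Longrightarrow> b i \<in> B i"
proof -
  have "\<exists>b. \<forall>i. i \<in> I \<longrightarrow> b i \<in> B i - b ` {j \<in> I. to_nat_on I j < to_nat_on I i}"
  proof (rule dependent_wf_choice[of "inv_image less_than (to_nat_on I)"
        "\<lambda>b i r. i \<in> I \<longrightarrow> r \<in> B i - b ` {j \<in> I. to_nat_on I j < to_nat_on I i}"])
    show "wf (inv_image less_than (to_nat_on I))" by simp
    show "\<And>f g x r. (\<And>z. (z, x) \<in> inv_image less_than (to_nat_on I) \<Longrightarrow> f z = g z) \<Longrightarrow>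
      (x \<in> I \<longrightarrow> r \<in> B x - f ` {j \<in> I. to_nat_on I j < to_nat_on I x}) =
      (x \<in> I \<longrightarrow> r \<in> B x - g ` {j \<in> I. to_nat_on I j < to_nat_on I x})"
      by (auto simp: image_iff)
    fix x f
    have "finite {j \<in> I. to_nat_on I j < to_nat_on I x}"
      by (rule inj_on_finite[of "to_nat_on I" _ "{..<to_nat_on I x}"])
        (use inj_on_to_nat_on[OF assms(1)] in \<open>auto simp: inj_on_def\<close>)
    then have "x \<in> I \<Longrightarrow> infinite (B x - f ` {j \<in> I. to_nat_on I j < to_nat_on I x})"
      using assms(2) by (simp add: Diff_infinite_finite)
    then show "\<exists>r. x \<in> I \<longrightarrow> r \<in> B x - f ` {j \<in> I. to_nat_on I j < to_nat_on I x}"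
      by (metis infinite_imp_nonempty ex_in_conv)
  qed
  then obtain b where b: "\<And>i. i \<in> I \<Longrightarrow> b i \<in> B i - b ` {j \<in> I. to_nat_on I j < to_nat_on I i}"
    by blast
  have "inj_on b I"
  proof (rule inj_onI, rule ccontr)
    fix i j assume ij: "i \<in> I" "j \<in> I" "b i = b j" "i \<noteq> j"
    then have "to_nat_on I i \<noteq> to_nat_on I j" using assms(1) by simp
    then consider "to_nat_on I i < to_nat_on I j" | "to_nat_on I j < to_nat_on I i" by linarith
    then show False by cases (use b[of i] b[of j] ij in \<open>auto simp: image_iff\<close>)
  qed
  with that b show ?thesis by blast
qed

text \<open>The points to be left over are chosen together with the representatives. This spare room
  is what later allows partial bijections to be completed to permutations.\<close>

lemma infinite_distinct_choice_sparse:
  assumes "countable I" and "countable K"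
    and "\<And>i. i \<in> I \<Longrightarrow> infinite (B i)" and "\<And>k. k \<in> K \<Longrightarrow> infinite (C k)"
  obtains b where "inj_on b I" and "\<And>i. i \<in> I \<Longrightarrow> b i \<in> B i"
    and "\<And>k. k \<in> K \<Longrightarrow> infinite (C k - b ` I)"
proof -
  \<comment> \<open>The index \<open>Inr (m, k)\<close> reserves the \<open>m\<close>-th spare point
    of \<open>C k\<close>; distinctness over the whole sum keeps it away from the representatives of
    \<open>I\<close>.\<close>
  let ?J = "I <+> ((UNIV::nat set) \<times> K)"
  let ?B = "case_sum B (\<lambda>(m::nat, k). C k)"
  have "countable ?J" using assms(1,2) by (intro countable_Plus countable_SIGMA) auto
  moreover have "\<And>i. i \<in> ?J \<Longrightarrow> infinite (?B i)" using assms(3,4) by auto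
  ultimately obtain b where b: "inj_on b ?J" "\<And>i. i \<in> ?J \<Longrightarrow> b i \<in> ?B i"
    using infinite_distinct_choice[of ?J ?B] by blast
  show ?thesis
  proof
    show "inj_on (b \<circ> Inl) I" using b(1) by (auto simp: inj_on_def)
    show "\<And>i. i \<in> I \<Longrightarrow> (b \<circ> Inl) i \<in> B i" using b(2) by fastforce
    fix k assume k: "k \<in> K"
    have "inj (\<lambda>m. b (Inr (m, k)))"
      using b(1) k by (auto simp: inj_on_def)
    then have "infinite (range (\<lambda>m. b (Inr (m, k))))"
      using finite_imageD infinite_UNIV_nat by blast
    moreover have "range (\<lambda>m. b (Inr (m, k))) \<subseteq> C k - (b \<circ> Inl) ` I"
    proof -
      have "b (Inr (m, k)) \<in> C k" for m using b(2)[of "Inr (m, k)"] k by auto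
      moreover have "b (Inr (m, k)) \<noteq> b (Inl i)" if "i \<in> I" for m i
        using b(1) k that by (auto simp: inj_on_def)
      ultimately show ?thesis by auto
    qed
    ultimately show "infinite (C k - (b \<circ> Inl) ` I)" using finite_subset by blast
  qed
qed

lemma countable_infinite_eqpoll:
  assumes "countable A" "infinite A" "countable B" "infinite B"
  shows "A \<approx> B"
  using assms by (meson bij_betw_inv bij_betw_trans countableE_infinite eqpoll_def)

subsection \<open>Charts and their inverses\<close>

lemma charts_iff:
  "f \<in> charts X \<longleftrightarrow>
     (\<forall>x y. f x = Some y \<longrightarrow> x \<in> X \<and> y \<in> X) \<and>
     (\<forall>x y z. f x = Some z \<longrightarrow> f y = Some z \<longrightarrow> x = y)"
proof -
  have "inj_on f (dom f) \<longleftrightarrow> (\<forall>x y z. f x = Some z \<longrightarrow> f y = Some z \<longrightarrow> x = y)"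
    by (fastforce simp: inj_on_def dom_def)
  moreover have "dom f \<subseteq> X \<and> ran f \<subseteq> X \<longleftrightarrow> (\<forall>x y. f x = Some y \<longrightarrow> x \<in> X \<and> y \<in> X)"
    by (auto simp: dom_def ran_def)
  ultimately show ?thesis
    by (simp only: charts_def mem_Collect_eq conj_assoc[symmetric])
qed

lemma charts_mem: "f \<in> charts X \<Longrightarrow> f x = Some y \<Longrightarrow> x \<in> X \<and> y \<in> X"
  by (simp add: charts_iff)

lemma charts_inj: "f \<in> charts X \<Longrightarrow> f x = Some z \<Longrightarrow> f y = Some z \<Longrightarrow> x = y"
  by (meson charts_iff)

lemma map_eqI_Some: "(\<And>x y. f x = Some y \<longleftrightarrow> g x = Some y) \<Longrightarrow> f = g"
  by (rule ext) (metis not_Some_eq)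

text \<open>Charts are built throughout as single-valued, injective relations on \<open>X\<close>,
  so that only their graphs have to be described.\<close>

lemma chart_of_relation:
  assumes "\<And>x y. P x y \<Longrightarrow> x \<in> X \<and> y \<in> X"
    and "\<And>x y z. P x y \<Longrightarrow> P x z \<Longrightarrow> y = z"
    and "\<And>x y z. P x z \<Longrightarrow> P y z \<Longrightarrow> x = y"
  obtains f where "f \<in> charts X" and "\<And>x y. f x = Some y \<longleftrightarrow> P x y"
proof -
  define f where "f x = (if \<exists>y. P x y then Some (SOME y. P x y) else None)" for x
  have "f x = Some y \<longleftrightarrow> P x y" for x y
    unfolding f_def using assms(2)[of x] by (auto intro: someI2 some_equality)
  note f = this
  have "f \<in> charts X" unfolding charts_iff f using assms(1,3) by blast
  then show ?thesis using f by (rule that)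
qed

lemma charts_comp: "f \<in> charts X \<Longrightarrow> g \<in> charts X \<Longrightarrow> g \<circ>\<^sub>m f \<in> charts X"
  unfolding charts_iff map_comp_Some_iff by metis

lemma dom_total_comp:
  assumes "f \<in> charts X" "dom f = X" "dom g = X"
  shows "dom (g \<circ>\<^sub>m f) = X"
proof -
  have "\<exists>z. (g \<circ>\<^sub>m f) x = Some z" if x: "x \<in> X" for x
  proof -
    obtain y where y: "f x = Some y" using x assms(2) by blast
    then have "y \<in> dom g" using charts_mem[OF assms(1)] assms(3) by blast
    then show ?thesis using y by (auto simp: map_comp_Some_iff)
  qed
  then have "X \<subseteq> dom (g \<circ>\<^sub>m f)" by blast
  moreover have "dom (g \<circ>\<^sub>m f) \<subseteq> dom f" by (auto simp: map_comp_Some_iff)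
  ultimately show ?thesis using assms(2) by blast
qed

lemma ran_comp_subset: "ran (g \<circ>\<^sub>m f) \<subseteq> ran g"
  by (auto simp: ran_def map_comp_Some_iff)

text \<open>For a chart the choice is forced by injectivity, and the result is its inverse in the
  symmetric inverse monoid.\<close>

definition chart_inv :: "('a \<rightharpoonup> 'a) \<Rightarrow> ('a \<rightharpoonup> 'a)" where
  "chart_inv f y = (if y \<in> ran f then Some (SOME x. f x = Some y) else None)"

lemma chart_inv_Some: "f \<in> charts X \<Longrightarrow> chart_inv f y = Some x \<longleftrightarrow> f x = Some y"
  unfolding chart_inv_def ran_def
  by (auto intro: someI2 some_equality dest: charts_inj)

lemma chart_inv_charts: "f \<in> charts X \<Longrightarrow> chart_inv f \<in> charts X"
  unfolding charts_iff[of "chart_inv f"] by (metis chart_inv_Some charts_mem option.inject)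

lemma chart_inv_inv [simp]: "f \<in> charts X \<Longrightarrow> chart_inv (chart_inv f) = f"
  by (rule map_eqI_Some) (simp add: chart_inv_Some[OF chart_inv_charts] chart_inv_Some)

lemma chart_inv_comp:
  "f \<in> charts X \<Longrightarrow> g \<in> charts X \<Longrightarrow> chart_inv (g \<circ>\<^sub>m f) = chart_inv f \<circ>\<^sub>m chart_inv g"
  by (rule map_eqI_Some)
    (auto simp: chart_inv_Some[OF charts_comp] chart_inv_Some map_comp_Some_iff)

lemma dom_chart_inv [simp]: "f \<in> charts X \<Longrightarrow> dom (chart_inv f) = ran f"
  by (auto simp: dom_def ran_def chart_inv_Some)

lemma ran_chart_inv [simp]: "f \<in> charts X \<Longrightarrow> ran (chart_inv f) = dom f"
  by (auto simp: dom_def ran_def chart_inv_Some)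

lemma inv_image_mem_iff:
  assumes "S \<subseteq> charts X" "f \<in> charts X"
  shows "f \<in> chart_inv ` S \<longleftrightarrow> chart_inv f \<in> S"
  using assms by (metis (no_types, lifting) chart_inv_inv imageE imageI subsetD)

lemma inv_image_inv_image: "S \<subseteq> charts X \<Longrightarrow> chart_inv ` chart_inv ` S = S"
proof -
  assume "S \<subseteq> charts X"
  then have "(\<lambda>x. chart_inv (chart_inv x)) ` S = id ` S" by (intro image_cong) auto
  then show ?thesis by (simp add: image_image)
qed

lemma inv_image_charts: "chart_inv ` charts X = charts X"
proof
  show sub: "chart_inv ` charts X \<subseteq> charts X" using chart_inv_charts by blast
  show "charts X \<subseteq> chart_inv ` charts X"
    using image_mono[OF sub, of chart_inv] inv_image_inv_image[of "charts X" X] by simp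
qed

lemma mult_sym_inv_monoid [simp]: "f \<otimes>\<^bsub>sym_inv_monoid X\<^esub> g = g \<circ>\<^sub>m f"
  and carrier_sym_inv_monoid [simp]: "carrier (sym_inv_monoid X) = charts X"
  by (simp_all add: sym_inv_monoid_def)

lemma subsemigroup_sym_inv_monoid:
  "subsemigroup T (sym_inv_monoid X) \<longleftrightarrow>
     T \<subseteq> charts X \<and> (\<forall>f\<in>T. \<forall>g\<in>T. g \<circ>\<^sub>m f \<in> T)"
  by (simp add: subsemigroup_def)

lemma subsemigroup_inv_image:
  assumes "subsemigroup T (sym_inv_monoid X)"
  shows "subsemigroup (chart_inv ` T) (sym_inv_monoid X)"
proof -
  have T: "T \<subseteq> charts X" "\<And>f g. f \<in> T \<Longrightarrow> g \<in> T \<Longrightarrow> g \<circ>\<^sub>m f \<in> T"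
    using assms by (auto simp: subsemigroup_sym_inv_monoid)
  have "chart_inv g \<circ>\<^sub>m chart_inv f \<in> chart_inv ` T" if "f \<in> T" "g \<in> T" for f g
    using that T chart_inv_comp[of g X f] by (metis imageI subsetD)
  then show ?thesis
    using T(1) chart_inv_charts[of _ X] by (auto simp: subsemigroup_sym_inv_monoid)
qed

text \<open>Inversion is an involution reversing products, so it permutes the proper subsemigroups
  and preserves their inclusions. This transfers maximality from \<open>A_part\<close> to
  \<open>A_part_inv\<close>.\<close>

lemma maximal_subsemigroup_inv_image:
  assumes "maximal_subsemigroup S (sym_inv_monoid X)"
  shows "maximal_subsemigroup (chart_inv ` S) (sym_inv_monoid X)"
  unfolding maximal_subsemigroup_def
proof (intro conjI allI impI)
  have S: "subsemigroup S (sym_inv_monoid X)" "S \<noteq> charts X" "S \<subseteq> charts X"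
    and max: "\<And>T. subsemigroup T (sym_inv_monoid X) \<Longrightarrow> T \<noteq> charts X \<Longrightarrow> S \<subseteq> T \<Longrightarrow> T = S"
    using assms by (auto simp: maximal_subsemigroup_def subsemigroup_sym_inv_monoid)
  show "subsemigroup (chart_inv ` S) (sym_inv_monoid X)"
    using S(1) by (rule subsemigroup_inv_image)
  show "chart_inv ` S \<noteq> carrier (sym_inv_monoid X)"
    using S by (metis carrier_sym_inv_monoid inv_image_charts inv_image_inv_image)
  fix T assume T: "subsemigroup T (sym_inv_monoid X) \<and> T \<noteq> carrier (sym_inv_monoid X)
      \<and> chart_inv ` S \<subseteq> T"
  then have T': "T \<subseteq> charts X" by (auto simp: subsemigroup_sym_inv_monoid)
  have "chart_inv ` T = S"
  proof (rule max)
    show "subsemigroup (chart_inv ` T) (sym_inv_monoid X)" using T subsemigroup_inv_image by blast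
    show "chart_inv ` T \<noteq> charts X"
      using T T' by (metis carrier_sym_inv_monoid inv_image_charts inv_image_inv_image)
    show "S \<subseteq> chart_inv ` T" using T S(3) by (metis image_mono inv_image_inv_image)
  qed
  then show "T = chart_inv ` S" using T' inv_image_inv_image by blast
qed

lemma sym_perms_inv: "f \<in> sym_perms X \<Longrightarrow> chart_inv f \<in> sym_perms X"
  unfolding sym_perms_def mem_Collect_eq by (metis chart_inv_charts dom_chart_inv ran_chart_inv)

lemma chart_image_iff: "y \<in> chart_image f S \<longleftrightarrow> (\<exists>x\<in>S. f x = Some y)"
  unfolding chart_image_def by (force simp: image_iff)

text \<open>The chart restricts to a bijection between the two sets. Hence \<open>rho\<close> can be
  tested on source points as well as on target points.\<close>

lemma finite_chart_pairs:
  assumes "f \<in> charts X"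
  shows "finite {y \<in> B. \<exists>x\<in>A. f x = Some y} \<longleftrightarrow> finite {x \<in> A. \<exists>y\<in>B. f x = Some y}"
proof -
  have "bij_betw (\<lambda>x. the (f x)) {x \<in> A. \<exists>y\<in>B. f x = Some y} {y \<in> B. \<exists>x\<in>A. f x = Some y}"
    unfolding bij_betw_def
  proof
    show "inj_on (\<lambda>x. the (f x)) {x \<in> A. \<exists>y\<in>B. f x = Some y}"
      using charts_inj[OF assms] by (auto simp: inj_on_def)
    show "(\<lambda>x. the (f x)) ` {x \<in> A. \<exists>y\<in>B. f x = Some y} = {y \<in> B. \<exists>x\<in>A. f x = Some y}"
      by (force simp: image_iff)
  qed
  then show ?thesis using bij_betw_finite by blast
qed

subsection \<open>Relations on a finite set of indices\<close>

text \<open>A missing pair \<open>(i, p i)\<close> removes \<open>i\<close> from the domain and, as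
  \<open>p\<close> is injective, \<open>p i\<close> from the range. Membership in
  \<open>A_part\<close> thus follows from a mere upper bound on \<open>rho\<close>.\<close>

lemma subset_perm_graph:
  assumes "R \<subseteq> {(i, p i) | i. i < n}" "p permutes {..<n}"
  shows "perm_graph n R \<or> Domain R \<noteq> {..<n} \<and> Range R \<noteq> {..<n}"
proof (cases "R = {(i, p i) | i. i < n}")
  case True
  then show ?thesis using assms(2) by (auto simp: perm_graph_def)
next
  case False
  then obtain i where i: "i < n" "(i, p i) \<notin> R" using assms(1) by blast
  then have "i \<notin> Domain R" using assms(1) by blast
  moreover have "p i \<notin> Range R"
    using assms(1) i injD[OF permutes_inj[OF assms(2)], of i] by blast
  moreover have "p i < n" using assms(2) i(1) permutes_in_image by fastforce
  ultimately show ?thesis using i(1) by blast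
qed

lemma perm_graph_converse:
  assumes "perm_graph n R" shows "perm_graph n (R\<inverse>)"
proof -
  obtain p where p: "p permutes {..<n}" "R = {(i, p i) | i. i < n}"
    using assms by (auto simp: perm_graph_def)
  have "R\<inverse> = {(i, inv_into UNIV p i) | i. i < n}"
  proof -
    have "(i < n \<and> j = p i) \<longleftrightarrow> (j < n \<and> i = inv_into UNIV p j)" for i j
      using permutes_in_image[OF p(1), of i] permutes_inverses[OF p(1)]
        permutes_in_image[OF permutes_inv[OF p(1)], of j] by auto
    then show ?thesis unfolding p(2) by auto
  qed
  then show ?thesis using permutes_inv[OF p(1)] by (auto simp: perm_graph_def)
qed

text \<open>Without a collision, any function selected from the total relation is injective, hence a
  permutation of the finite index set. Its values then exhaust all indices, and a further pair would
  collide with one of the selected pairs.\<close>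

lemma total_not_perm_graph_collision:
  assumes "R \<subseteq> {..<n} \<times> {..<n}" "Domain R = {..<n}" "\<not> perm_graph n R"
  obtains i i' j where "i \<noteq> i'" "(i, j) \<in> R" "(i', j) \<in> R"
proof (rule ccontr)
  assume "\<not> thesis"
  then have inj: "\<And>i i' j. (i, j) \<in> R \<Longrightarrow> (i', j) \<in> R \<Longrightarrow> i = i'" using that by blast
  \<comment> \<open>The value \<open>i\<close> outside \<open>{..<n}\<close> is the one that
    \<open>permutes\<close> prescribes.\<close>
  define p where "p i = (if i < n then SOME j. (i, j) \<in> R else i)" for i
  have p: "(i, p i) \<in> R" if "i < n" for i
  proof -
    have "\<exists>j. (i, j) \<in> R" using assms(2) that by blast
    then show ?thesis using that unfolding p_def by (auto intro: someI_ex)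
  qed
  have "inj_on p {..<n}" using p inj by (metis inj_onI lessThan_iff)
  moreover have "p ` {..<n} \<subseteq> {..<n}" using p assms(1) by auto
  ultimately have "bij_betw p {..<n} {..<n}" by (simp add: bij_betw_def endo_inj_surj)
  then have perm: "p permutes {..<n}" by (rule bij_imp_permutes) (simp add: p_def)
  have "j = p i" if "(i, j) \<in> R" for i j
  proof -
    have "j \<in> p ` {..<n}" using that assms(1) permutes_image[OF perm] by auto
    then obtain i' where "i' < n" "p i' = j" by auto
    then show ?thesis using inj[OF that] p by metis
  qed
  then have "R = {(i, p i) | i. i < n}" using p assms(1) by blast
  then show False using perm assms(3) by (auto simp: perm_graph_def)
qed

text \<open>The first transposition moves \<open>a\<close> to \<open>c\<close>. The second moves the
  current image of \<open>b\<close> to \<open>d\<close> and fixes \<open>c\<close>, because that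
  image and \<open>d\<close> both differ from \<open>c\<close>.\<close>

lemma ex_permutes_two:
  assumes "a < n" "b < n" "c < n" "d < (n::nat)" "a \<noteq> b" "c \<noteq> d"
  obtains p where "p permutes {..<n}" "p a = c" "p b = d"
proof
  let ?t = "transpose a c"
  have "?t b < n" using assms by (auto simp: transpose_def)
  then show "transpose (?t b) d \<circ> ?t permutes {..<n}"
    using assms by (intro permutes_compose permutes_swap_id) auto
  show "(transpose (?t b) d \<circ> ?t) a = c" "(transpose (?t b) d \<circ> ?t) b = d"
    using assms by (auto simp: transpose_def)
qed

subsection \<open>Charts and a partition into infinite parts\<close>

lemma infinite_chart_image:
  assumes "f \<in> charts X" "infinite S" "S \<subseteq> dom f"
  shows "infinite {y. \<exists>x\<in>S. f x = Some y}"
proof -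
  have "{x \<in> S. \<exists>y\<in>UNIV. f x = Some y} = S" using assms(3) by auto
  then show ?thesis using finite_chart_pairs[OF assms(1), of UNIV S] assms(2) by simp
qed

lemma infinite_chart_preimage:
  assumes "f \<in> charts X" "infinite S" "S \<subseteq> ran f"
  shows "infinite {x. \<exists>y\<in>S. f x = Some y}"
proof -
  have "{y \<in> S. \<exists>x\<in>UNIV. f x = Some y} = S" using assms(3) by (auto simp: ran_def)
  then show ?thesis using finite_chart_pairs[OF assms(1), of S UNIV] assms(2) by simp
qed

text \<open>For subsets of a countably infinite \<open>X\<close>, equipollence with \<open>X\<close>
  just means being infinite. The number of parts is arbitrary here, so that the partition with the
  single part \<open>X\<close> is also an instance; it serves to produce general
  permutations.\<close>

locale infinite_partition =
  fixes X :: "'a set" and n :: nat and \<Sigma> :: "nat \<Rightarrow> 'a set"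
  assumes countable: "countable X"
    and cover: "(\<Union>i<n. \<Sigma> i) = X"
    and disjoint: "disjoint_family_on \<Sigma> {..<n}"
    and infinite_part: "i < n \<Longrightarrow> infinite (\<Sigma> i)"
begin

lemma part_subset: "i < n \<Longrightarrow> \<Sigma> i \<subseteq> X"
  using cover by auto

lemma part_ex: "x \<in> X \<Longrightarrow> \<exists>i<n. x \<in> \<Sigma> i"
  using cover by auto

lemma part_unique: "i < n \<Longrightarrow> j < n \<Longrightarrow> x \<in> \<Sigma> i \<Longrightarrow> x \<in> \<Sigma> j \<Longrightarrow> i = j"
  using disjoint by (auto simp: disjoint_family_on_def)

lemma eqpoll_X_iff: "0 < n \<Longrightarrow> A \<subseteq> X \<Longrightarrow> A \<approx> X \<longleftrightarrow> infinite A"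
  using countable infinite_part part_subset
  by (meson countable_infinite_eqpoll countable_subset eqpoll_finite_iff finite_subset)

lemma pigeonhole_part:
  assumes "infinite A" "A \<subseteq> X"
  obtains i where "i < n" "infinite (A \<inter> \<Sigma> i)"
proof -
  have "\<forall>a\<in>A. \<exists>i\<in>{..<n}. a \<in> \<Sigma> i" using assms(2) part_ex by fastforce
  then obtain i where "i < n" "infinite {a \<in> A. a \<in> \<Sigma> i}"
    using pigeonhole_infinite_rel[OF assms(1) finite_lessThan, of n "\<lambda>a i. a \<in> \<Sigma> i"] by auto
  then show ?thesis using that by (simp add: Collect_conj_eq Int_commute)
qed

lemma rho_iff:
  assumes "f \<in> charts X"
  shows "(i, j) \<in> rho X n \<Sigma> f \<longleftrightarrow> i < n \<and> j < n \<and> infinite {y \<in> \<Sigma> j. \<exists>x\<in>\<Sigma> i. f x = Some y}"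
proof -
  have eq: "chart_image f (\<Sigma> i) \<inter> \<Sigma> j = {y \<in> \<Sigma> j. \<exists>x\<in>\<Sigma> i. f x = Some y}"
    by (auto simp: chart_image_iff)
  show ?thesis
    unfolding rho_def mem_Collect_eq prod.case eq
    using eqpoll_X_iff[of "{y \<in> \<Sigma> j. \<exists>x\<in>\<Sigma> i. f x = Some y}"] part_subset[of j] by auto
qed

lemma rho_iff':
  assumes "f \<in> charts X"
  shows "(i, j) \<in> rho X n \<Sigma> f \<longleftrightarrow> i < n \<and> j < n \<and> infinite {x \<in> \<Sigma> i. \<exists>y\<in>\<Sigma> j. f x = Some y}"
  using rho_iff[OF assms] finite_chart_pairs[OF assms] by blast

lemma rho_subset: "rho X n \<Sigma> f \<subseteq> {..<n} \<times> {..<n}"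
  by (auto simp: rho_def)

lemma Domain_rho_subset: "Domain (rho X n \<Sigma> f) \<subseteq> {..<n}"
  by (auto simp: rho_def)

lemma rho_inv: "f \<in> charts X \<Longrightarrow> rho X n \<Sigma> (chart_inv f) = (rho X n \<Sigma> f)\<inverse>"
  by (auto simp: rho_iff rho_iff'[OF chart_inv_charts] chart_inv_Some)

text \<open>The image of a part under a total chart is infinite, so it meets one of the finitely
  many parts infinitely often.\<close>

lemma Domain_rho:
  assumes "f \<in> charts X" "dom f = X"
  shows "Domain (rho X n \<Sigma> f) = {..<n}"
proof -
  have "\<exists>j. (i, j) \<in> rho X n \<Sigma> f" if i: "i < n" for i
  proof -
    have "\<Sigma> i \<subseteq> dom f" using part_subset i assms(2) by blast
    then obtain j where "j < n" "infinite ({y. \<exists>x\<in>\<Sigma> i. f x = Some y} \<inter> \<Sigma> j)"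
      using pigeonhole_part[of "{y. \<exists>x\<in>\<Sigma> i. f x = Some y}"]
        infinite_chart_image[OF assms(1) infinite_part[OF i]] charts_mem[OF assms(1)] by blast
    moreover have "{y. \<exists>x\<in>\<Sigma> i. f x = Some y} \<inter> \<Sigma> j = {y \<in> \<Sigma> j. \<exists>x\<in>\<Sigma> i. f x = Some y}"
      by blast
    ultimately show ?thesis using i rho_iff[OF assms(1)] by auto
  qed
  then show ?thesis using rho_subset[of f] by auto
qed

text \<open>Infinitely many paths from part \<open>i\<close> to part \<open>k\<close> pass through
  finitely many middle parts, so one part \<open>j\<close> carries infinitely many of them. The
  converse inclusion can fail, since the image of \<open>f\<close> and the domain of
  \<open>g\<close> may miss each other inside part \<open>j\<close>.\<close>

lemma rho_comp:
  assumes f: "f \<in> charts X" and g: "g \<in> charts X"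
  shows "rho X n \<Sigma> (g \<circ>\<^sub>m f) \<subseteq> rho X n \<Sigma> f O rho X n \<Sigma> g"
proof (rule subrelI)
  fix i k assume "(i, k) \<in> rho X n \<Sigma> (g \<circ>\<^sub>m f)"
  then have ik: "i < n" "k < n"
    and inf: "infinite {x \<in> \<Sigma> i. \<exists>z\<in>\<Sigma> k. (g \<circ>\<^sub>m f) x = Some z}" (is "infinite ?S")
    by (auto simp: rho_iff'[OF charts_comp[OF f g]])
  have "?S \<subseteq> dom f" by (auto simp: map_comp_Some_iff)
  then have "infinite {y. \<exists>x\<in>?S. f x = Some y}" using infinite_chart_image[OF f inf] by blast
  moreover have "{y. \<exists>x\<in>?S. f x = Some y} \<subseteq> X" using charts_mem[OF f] by blast
  ultimately obtain j where j: "j < n" "infinite ({y. \<exists>x\<in>?S. f x = Some y} \<inter> \<Sigma> j)" (is "infinite ?U")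
    by (rule pigeonhole_part)
  have "?U \<subseteq> {y \<in> \<Sigma> j. \<exists>x\<in>\<Sigma> i. f x = Some y}"
    and "?U \<subseteq> {y \<in> \<Sigma> j. \<exists>z\<in>\<Sigma> k. g y = Some z}"
    by (auto simp: map_comp_Some_iff)
  then have "(i, j) \<in> rho X n \<Sigma> f" "(j, k) \<in> rho X n \<Sigma> g"
    using j ik finite_subset unfolding rho_iff[OF f] rho_iff'[OF g] by blast+
  then show "(i, k) \<in> rho X n \<Sigma> f O rho X n \<Sigma> g" by blast
qed

section \<open>Constructing elements of the stabiliser\<close>

lemma fun_Stab:
  assumes \<sigma>: "\<sigma> permutes {..<n}" and F: "\<And>i. i < n \<Longrightarrow> bij_betw F (\<Sigma> i) (\<Sigma> (\<sigma> i))"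
  shows "(\<lambda>x. if x \<in> X then Some (F x) else None) \<in> Stab X n \<Sigma>" (is "?s \<in> _")
proof -
  have \<sigma>n: "\<sigma> i < n" if "i < n" for i using permutes_in_image[OF \<sigma>] that by auto
  have disj: "disjoint_family_on (\<lambda>i. \<Sigma> (\<sigma> i)) {..<n}"
  proof (unfold disjoint_family_on_def, intro ballI impI)
    fix i j assume "i \<in> {..<n}" "j \<in> {..<n}" "i \<noteq> j"
    then have "\<sigma> i \<noteq> \<sigma> j" "\<sigma> i < n" "\<sigma> j < n"
      using injD[OF permutes_inj[OF \<sigma>]] \<sigma>n by auto
    then show "\<Sigma> (\<sigma> i) \<inter> \<Sigma> (\<sigma> j) = {}" using part_unique by blast
  qed
  have "(\<Union>i<n. \<Sigma> (\<sigma> i)) = (\<Union>i\<in>\<sigma> ` {..<n}. \<Sigma> i)" by (simp add: image_image)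
  then have "(\<Union>i<n. \<Sigma> (\<sigma> i)) = X" using cover permutes_image[OF \<sigma>] by simp
  moreover have "bij_betw F (\<Union>i<n. \<Sigma> i) (\<Union>i<n. \<Sigma> (\<sigma> i))"
    by (rule bij_betw_UNION_disjoint[OF disj]) (use F in auto)
  ultimately have bij: "bij_betw F X X" using cover by simp
  have "?s \<in> charts X"
    using bij unfolding charts_iff by (auto simp: bij_betw_def inj_on_def split: if_splits)
  moreover have "dom ?s = X" by (auto simp: dom_def)
  moreover have "ran ?s = F ` X" by (auto simp: ran_def)
  then have "ran ?s = X" using bij by (simp add: bij_betw_def)
  moreover have "chart_image ?s (\<Sigma> i) = \<Sigma> (\<sigma> i)" if "i < n" for i
  proof -
    have "\<Sigma> i \<inter> dom ?s = \<Sigma> i" using part_subset[OF that] by (auto simp: dom_def)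
    moreover have "(\<lambda>x. the (?s x)) ` \<Sigma> i = F ` \<Sigma> i"
      using part_subset[OF that] by (intro image_cong) auto
    ultimately show ?thesis using F[OF that] by (simp add: chart_image_def bij_betw_def)
  qed
  then have "\<forall>i<n. \<exists>j<n. chart_image ?s (\<Sigma> i) = \<Sigma> j" using \<sigma>n by blast
  ultimately show ?thesis by (simp add: Stab_def sym_perms_def)
qed

lemma extend_to_Stab:
  assumes \<psi>: "\<psi> \<in> charts X" and \<sigma>: "\<sigma> permutes {..<n}"
    and resp: "\<And>i x y. i < n \<Longrightarrow> x \<in> \<Sigma> i \<Longrightarrow> \<psi> x = Some y \<Longrightarrow> y \<in> \<Sigma> (\<sigma> i)"
    and codom: "\<And>i. i < n \<Longrightarrow> infinite (\<Sigma> i - dom \<psi>)"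
    and coran: "\<And>i. i < n \<Longrightarrow> infinite (\<Sigma> i - ran \<psi>)"
  obtains s where "s \<in> Stab X n \<Sigma>" "\<And>x y. \<psi> x = Some y \<Longrightarrow> s x = Some y"
    "\<And>i x y. i < n \<Longrightarrow> x \<in> \<Sigma> i \<Longrightarrow> s x = Some y \<Longrightarrow> y \<in> \<Sigma> (\<sigma> i)"
proof -
  have \<sigma>n: "\<sigma> i < n" if "i < n" for i using permutes_in_image[OF \<sigma>] that by auto
  have "\<exists>t. bij_betw t (\<Sigma> i - dom \<psi>) (\<Sigma> (\<sigma> i) - ran \<psi>)" if "i < n" for i
  proof -
    have "countable (\<Sigma> i - dom \<psi>)" "countable (\<Sigma> (\<sigma> i) - ran \<psi>)"
      using countable part_subset \<sigma>n that by (meson countable_Diff countable_subset)+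
    then show ?thesis
      using countable_infinite_eqpoll codom[OF that] coran[OF \<sigma>n[OF that]] unfolding eqpoll_def
      by blast
  qed
  then obtain t where t: "\<And>i. i < n \<Longrightarrow> bij_betw (t i) (\<Sigma> i - dom \<psi>) (\<Sigma> (\<sigma> i) - ran \<psi>)"
    by metis
  define p where "p x = (THE i. i < n \<and> x \<in> \<Sigma> i)" for x
  have p: "p x = i" if "i < n" "x \<in> \<Sigma> i" for x i
    unfolding p_def using that part_unique by (intro the_equality) auto
  define F where "F x = (case \<psi> x of Some y \<Rightarrow> y | None \<Rightarrow> t (p x) x)" for x
  have F: "bij_betw F (\<Sigma> i) (\<Sigma> (\<sigma> i))" if i: "i < n" for i
  proof -
    have "bij_betw F (\<Sigma> i - dom \<psi>) (\<Sigma> (\<sigma> i) - ran \<psi>)"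
      using t[OF i] by (rule bij_betw_cong[THEN iffD1, rotated]) (use p i in \<open>auto simp: F_def dom_def\<close>)
    moreover have "bij_betw F (\<Sigma> i \<inter> dom \<psi>) (\<Sigma> (\<sigma> i) \<inter> ran \<psi>)"
      unfolding bij_betw_def
    proof
      show "inj_on F (\<Sigma> i \<inter> dom \<psi>)"
        using charts_inj[OF \<psi>] by (auto simp: inj_on_def F_def)
      show "F ` (\<Sigma> i \<inter> dom \<psi>) = \<Sigma> (\<sigma> i) \<inter> ran \<psi>"
      proof
        show "F ` (\<Sigma> i \<inter> dom \<psi>) \<subseteq> \<Sigma> (\<sigma> i) \<inter> ran \<psi>"
          using resp[OF i] by (auto simp: F_def ran_def)
        show "\<Sigma> (\<sigma> i) \<inter> ran \<psi> \<subseteq> F ` (\<Sigma> i \<inter> dom \<psi>)"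
        proof
          \<comment> \<open>The source of \<open>y\<close> lies in some part \<open>i'\<close>. By
            \<open>resp\<close>, \<open>y\<close> is in part \<open>\<sigma> i'\<close>, so
            injectivity of \<open>\<sigma>\<close> gives \<open>i' = i\<close>.\<close>
          fix y assume y: "y \<in> \<Sigma> (\<sigma> i) \<inter> ran \<psi>"
          then obtain x where x: "\<psi> x = Some y" by (auto simp: ran_def)
          then obtain i' where i': "i' < n" "x \<in> \<Sigma> i'" using charts_mem[OF \<psi>] part_ex by blast
          then have "\<sigma> i' = \<sigma> i" using part_unique[OF \<sigma>n[OF i'(1)] \<sigma>n[OF i] resp[OF i' x]] y by blast
          then have "i' = i" using injD[OF permutes_inj[OF \<sigma>]] by blast
          then show "y \<in> F ` (\<Sigma> i \<inter> dom \<psi>)"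
            using i' x by (intro image_eqI[of _ _ x]) (auto simp: F_def)
        qed
      qed
    qed
    ultimately have "bij_betw F ((\<Sigma> i - dom \<psi>) \<union> (\<Sigma> i \<inter> dom \<psi>))
        ((\<Sigma> (\<sigma> i) - ran \<psi>) \<union> (\<Sigma> (\<sigma> i) \<inter> ran \<psi>))"
      by (rule bij_betw_combine) auto
    then show ?thesis by (simp add: Un_Diff_Int)
  qed
  let ?s = "\<lambda>x. if x \<in> X then Some (F x) else None"
  show ?thesis
  proof
    show "?s \<in> Stab X n \<Sigma>" using fun_Stab[OF \<sigma> F] by blast
    show "\<And>x y. \<psi> x = Some y \<Longrightarrow> ?s x = Some y" using charts_mem[OF \<psi>] by (auto simp: F_def)
    show "\<And>i x y. i < n \<Longrightarrow> x \<in> \<Sigma> i \<Longrightarrow> ?s x = Some y \<Longrightarrow> y \<in> \<Sigma> (\<sigma> i)"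
      using bij_betwE[OF F] by (auto split: if_splits)
  qed
qed

text \<open>All requirements \<open>c\<close> are met by one element: for every pair
  \<open>(m, c)\<close> with \<open>m\<close> a natural number, distinct points of
  \<open>A c\<close> and of \<open>B c\<close> are chosen and matched. The choices leave infinitely
  many points of every part free, so the matching extends to the stabiliser, and varying
  \<open>m\<close> yields infinitely many matches for each \<open>c\<close>.\<close>

lemma Stab_infinite_meets:
  assumes \<sigma>: "\<sigma> permutes {..<n}" and "countable C"
    and J: "\<And>c. c \<in> C \<Longrightarrow> J c < n"
    and A: "\<And>c. c \<in> C \<Longrightarrow> A c \<subseteq> \<Sigma> (J c)" "\<And>c. c \<in> C \<Longrightarrow> infinite (A c)"
    and B: "\<And>c. c \<in> C \<Longrightarrow> B c \<subseteq> \<Sigma> (\<sigma> (J c))" "\<And>c. c \<in> C \<Longrightarrow> infinite (B c)"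
  obtains s where "s \<in> Stab X n \<Sigma>"
    "\<And>c. c \<in> C \<Longrightarrow> infinite {y \<in> B c. \<exists>x\<in>A c. s x = Some y}"
proof -
  have \<sigma>n: "\<sigma> i < n" if "i < n" for i using permutes_in_image[OF \<sigma>] that by auto
  let ?I = "(UNIV::nat set) \<times> C"
  have I: "countable ?I" using assms(2) by blast
  obtain a where a: "inj_on a ?I" "\<And>i. i \<in> ?I \<Longrightarrow> a i \<in> A (snd i)"
    "\<And>k. k \<in> {..<n} \<Longrightarrow> infinite (\<Sigma> k - a ` ?I)"
  proof (rule infinite_distinct_choice_sparse[OF I, of "{..<n}" "\<lambda>i. A (snd i)" \<Sigma>])
    show "countable {..<n}" by simp
    show "\<And>i. i \<in> ?I \<Longrightarrow> infinite (A (snd i))" using A(2) by auto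
    show "\<And>k. k \<in> {..<n} \<Longrightarrow> infinite (\<Sigma> k)" using infinite_part by simp
  qed (rule that)
  obtain b where b: "inj_on b ?I" "\<And>i. i \<in> ?I \<Longrightarrow> b i \<in> B (snd i)"
    "\<And>k. k \<in> {..<n} \<Longrightarrow> infinite (\<Sigma> k - b ` ?I)"
  proof (rule infinite_distinct_choice_sparse[OF I, of "{..<n}" "\<lambda>i. B (snd i)" \<Sigma>])
    show "countable {..<n}" by simp
    show "\<And>i. i \<in> ?I \<Longrightarrow> infinite (B (snd i))" using B(2) by auto
    show "\<And>k. k \<in> {..<n} \<Longrightarrow> infinite (\<Sigma> k)" using infinite_part by simp
  qed (rule that)
  have aS: "a i \<in> \<Sigma> (J (snd i))" and bS: "b i \<in> \<Sigma> (\<sigma> (J (snd i)))" if "i \<in> ?I" for i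
    using a(2)[OF that] b(2)[OF that] A(1)[of "snd i"] B(1)[of "snd i"] that by auto
  obtain \<psi> where \<psi>: "\<psi> \<in> charts X" "\<And>x y. \<psi> x = Some y \<longleftrightarrow> (\<exists>i\<in>?I. x = a i \<and> y = b i)"
  proof (rule chart_of_relation[of "\<lambda>x y. \<exists>i\<in>?I. x = a i \<and> y = b i" X])
    fix x y assume "\<exists>i\<in>?I. x = a i \<and> y = b i"
    then obtain i where i: "i \<in> ?I" "x = a i" "y = b i" by blast
    then have "J (snd i) < n" using J by auto
    then show "x \<in> X \<and> y \<in> X"
      using subsetD[OF part_subset aS[OF i(1)]] subsetD[OF part_subset[OF \<sigma>n] bS[OF i(1)]] i by simp
  next
    show "\<And>x y z. \<exists>i\<in>?I. x = a i \<and> y = b i \<Longrightarrow> \<exists>i\<in>?I. x = a i \<and> z = b i \<Longrightarrow> y = z"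
      using inj_onD[OF a(1)] by metis
    show "\<And>x y z. \<exists>i\<in>?I. x = a i \<and> z = b i \<Longrightarrow> \<exists>i\<in>?I. y = a i \<and> z = b i \<Longrightarrow> x = y"
      using inj_onD[OF b(1)] by metis
  qed (rule that)
  have dom_ran: "dom \<psi> = a ` ?I" "ran \<psi> = b ` ?I" by (auto simp: dom_def ran_def \<psi>(2) image_iff)
  have resp: "y \<in> \<Sigma> (\<sigma> i)" if i: "i < n" "x \<in> \<Sigma> i" and "\<psi> x = Some y" for i x y
  proof -
    obtain c where c: "c \<in> ?I" "x = a c" "y = b c" using \<open>\<psi> x = Some y\<close> \<psi>(2) by blast
    then have "J (snd c) = i" using J aS i part_unique[of "J (snd c)" i x] by auto
    then show ?thesis using bS c by blast
  qed
  obtain s where s: "s \<in> Stab X n \<Sigma>" "\<And>x y. \<psi> x = Some y \<Longrightarrow> s x = Some y"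
  proof (rule extend_to_Stab[OF \<psi>(1) \<sigma>])
    show "\<And>i x y. i < n \<Longrightarrow> x \<in> \<Sigma> i \<Longrightarrow> \<psi> x = Some y \<Longrightarrow> y \<in> \<Sigma> (\<sigma> i)" by (rule resp)
    show "\<And>i. i < n \<Longrightarrow> infinite (\<Sigma> i - dom \<psi>)" using a(3) by (simp add: dom_ran)
    show "\<And>i. i < n \<Longrightarrow> infinite (\<Sigma> i - ran \<psi>)" using b(3) by (simp add: dom_ran)
  qed (rule that)
  have "infinite {y \<in> B c. \<exists>x\<in>A c. s x = Some y}" if c: "c \<in> C" for c
  proof -
    have "inj (\<lambda>m. b (m, c))" using b(1) c by (auto simp: inj_on_def)
    then have "infinite (range (\<lambda>m. b (m, c)))" using finite_imageD infinite_UNIV_nat by blast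
    moreover have "range (\<lambda>m. b (m, c)) \<subseteq> {y \<in> B c. \<exists>x\<in>A c. s x = Some y}"
    proof
      fix y assume "y \<in> range (\<lambda>m. b (m, c))"
      then obtain m where m: "y = b (m, c)" by blast
      have "s (a (m, c)) = Some y" using c m by (intro s(2)) (auto simp: \<psi>(2))
      then show "y \<in> {y \<in> B c. \<exists>x\<in>A c. s x = Some y}"
        using a(2)[of "(m, c)"] b(2)[of "(m, c)"] c m by auto
    qed
    ultimately show ?thesis using finite_subset by blast
  qed
  with s(1) show ?thesis by (rule that)
qed

lemma Stab_charts: "s \<in> Stab X n \<Sigma> \<Longrightarrow> s \<in> charts X"
  by (simp add: Stab_def sym_perms_def)

text \<open>A counterpart to \<open>rho_comp\<close>: a suitable \<open>s\<close> carries infinitely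
  many points of the image of part \<open>i\<close> in part \<open>j\<close> to points of part
  \<open>\<sigma> j\<close> that \<open>g\<close> sends to part \<open>k\<close>, for all such
  triples at once. Composition of charts then realises at least the composition of the relations,
  twisted by \<open>\<sigma>\<close>.\<close>

lemma rho_comp_Stab:
  assumes f: "f \<in> charts X" and g: "g \<in> charts X" and \<sigma>: "\<sigma> permutes {..<n}"
  obtains s where "s \<in> Stab X n \<Sigma>"
    "\<And>i j k. (i, j) \<in> rho X n \<Sigma> f \<Longrightarrow> (\<sigma> j, k) \<in> rho X n \<Sigma> g \<Longrightarrow>
      (i, k) \<in> rho X n \<Sigma> (g \<circ>\<^sub>m (s \<circ>\<^sub>m f))"
proof -
  let ?C = "{(i, j, k). (i, j) \<in> rho X n \<Sigma> f \<and> (\<sigma> j, k) \<in> rho X n \<Sigma> g}"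
  let ?A = "\<lambda>(i, j, k). {y \<in> \<Sigma> j. \<exists>x\<in>\<Sigma> i. f x = Some y}"
  let ?B = "\<lambda>(i, j, k). {y \<in> \<Sigma> (\<sigma> j). \<exists>z\<in>\<Sigma> k. g y = Some z}"
  obtain s where s: "s \<in> Stab X n \<Sigma>"
    "\<And>c. c \<in> ?C \<Longrightarrow> infinite {y \<in> ?B c. \<exists>x\<in>?A c. s x = Some y}"
  proof (rule Stab_infinite_meets[OF \<sigma>, of ?C "\<lambda>(i, j, k). j" ?A ?B])
    show "countable ?C" by auto
  qed (auto simp: rho_iff[OF f] rho_iff'[OF g])
  have "(i, k) \<in> rho X n \<Sigma> (g \<circ>\<^sub>m (s \<circ>\<^sub>m f))"
    if ij: "(i, j) \<in> rho X n \<Sigma> f" and jk: "(\<sigma> j, k) \<in> rho X n \<Sigma> g" for i j k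
  proof -
    let ?S = "{y \<in> ?B (i, j, k). \<exists>x\<in>?A (i, j, k). s x = Some y}"
    have "infinite ?S" using s(2)[of "(i, j, k)"] ij jk by auto
    moreover have "?S \<subseteq> dom g" by auto
    ultimately have "infinite {z. \<exists>y\<in>?S. g y = Some z}" using infinite_chart_image[OF g] by blast
    moreover have "{z. \<exists>y\<in>?S. g y = Some z}
        \<subseteq> {z \<in> \<Sigma> k. \<exists>x\<in>\<Sigma> i. (g \<circ>\<^sub>m (s \<circ>\<^sub>m f)) x = Some z}"
      by (auto simp: map_comp_Some_iff)
    ultimately have "infinite {z \<in> \<Sigma> k. \<exists>x\<in>\<Sigma> i. (g \<circ>\<^sub>m (s \<circ>\<^sub>m f)) x = Some z}"
      using finite_subset by blast
    moreover have "i < n" "k < n" using ij jk rho_subset by blast+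
    ultimately show ?thesis
      using rho_iff[OF charts_comp[OF charts_comp[OF f Stab_charts[OF s(1)]] g]] by blast
  qed
  with s(1) show ?thesis by (rule that)
qed

text \<open>The definition of \<open>Stab\<close> says only that parts go onto parts, so it must be
  seen that every part is hit. The preimage of a point of part \<open>j\<close> lies in some part
  \<open>i\<close>, whose image is a part containing that point and hence is part
  \<open>j\<close>.\<close>

lemma Stab_inv:
  assumes "s \<in> Stab X n \<Sigma>" shows "chart_inv s \<in> Stab X n \<Sigma>"
proof -
  have s: "s \<in> charts X" "dom s = X" "ran s = X" "s \<in> sym_perms X"
    and im: "\<And>i. i < n \<Longrightarrow> \<exists>j<n. chart_image s (\<Sigma> i) = \<Sigma> j"
    using assms by (auto simp: Stab_def sym_perms_def)
  have "\<exists>i<n. chart_image (chart_inv s) (\<Sigma> j) = \<Sigma> i" if j: "j < n" for j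
  proof -
    obtain y where y: "y \<in> \<Sigma> j" using infinite_imp_nonempty[OF infinite_part[OF j]] by blast
    then have "y \<in> ran s" using part_subset j s(3) by blast
    then obtain x where x: "s x = Some y" by (auto simp: ran_def)
    then obtain i where i: "i < n" "x \<in> \<Sigma> i" using charts_mem[OF s(1)] part_ex by blast
    obtain j' where "j' < n" "chart_image s (\<Sigma> i) = \<Sigma> j'" using im i(1) by blast
    moreover have "y \<in> chart_image s (\<Sigma> i)" using x i by (auto simp: chart_image_iff)
    ultimately have ij: "chart_image s (\<Sigma> i) = \<Sigma> j" using part_unique[OF j _ y] by metis
    have "chart_image (chart_inv s) (\<Sigma> j) = \<Sigma> i"
    proof (rule Set.set_eqI)
      fix x
      have "x \<in> chart_image (chart_inv s) (\<Sigma> j) \<longleftrightarrow> (\<exists>y\<in>chart_image s (\<Sigma> i). s x = Some y)"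
        by (simp add: chart_image_iff[of x] chart_inv_Some[OF s(1)] ij)
      also have "\<dots> \<longleftrightarrow> (\<exists>x'\<in>\<Sigma> i. \<exists>y. s x' = Some y \<and> s x = Some y)"
        by (auto simp: chart_image_iff)
      also have "\<dots> \<longleftrightarrow> x \<in> \<Sigma> i"
      proof
        assume "x \<in> \<Sigma> i"
        then have "x \<in> dom s" using part_subset i(1) s(2) by blast
        with \<open>x \<in> \<Sigma> i\<close> show "\<exists>x'\<in>\<Sigma> i. \<exists>y. s x' = Some y \<and> s x = Some y" by blast
      qed (use charts_inj[OF s(1)] in blast)
      finally show "x \<in> chart_image (chart_inv s) (\<Sigma> j) \<longleftrightarrow> x \<in> \<Sigma> i" .
    qed
    with i(1) show ?thesis by blast
  qed
  then show ?thesis using sym_perms_inv[OF s(4)] by (simp add: Stab_def)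
qed

section \<open>The two semigroups of the theorem\<close>

lemma A_part_if_rho_subset:
  assumes "f \<in> charts X" "p permutes {..<n}" "rho X n \<Sigma> f \<subseteq> {(i, p i) | i. i < n}"
  shows "f \<in> A_part X n \<Sigma>"
  using subset_perm_graph[OF assms(3,2)] assms(1) by (auto simp: A_part_def)

text \<open>The induced map on indices is injective, since a point of a common image part would have
  preimages in two parts. On a finite index set it is therefore a permutation, and its graph
  contains \<open>rho\<close>.\<close>

lemma Stab_subset_A_part: "Stab X n \<Sigma> \<subseteq> A_part X n \<Sigma>"
proof
  fix s assume "s \<in> Stab X n \<Sigma>"
  then have s: "s \<in> charts X" "dom s = X" and im: "\<And>i. i < n \<Longrightarrow> \<exists>j<n. chart_image s (\<Sigma> i) = \<Sigma> j"
    by (auto simp: Stab_def sym_perms_def)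
  obtain p where p: "\<And>i. i < n \<Longrightarrow> p i < n \<and> chart_image s (\<Sigma> i) = \<Sigma> (p i)"
    using im by metis
  define q where "q i = (if i < n then p i else i)" for i
  have inj: "inj_on q {..<n}"
  proof (rule inj_onI)
    fix i i' assume "i \<in> {..<n}" "i' \<in> {..<n}" "q i = q i'"
    then have i: "i < n" "i' < n" "p i = p i'" by (auto simp: q_def)
    obtain y where "y \<in> \<Sigma> (p i)"
      using infinite_imp_nonempty[OF infinite_part[of "p i"]] p[OF i(1)] by blast
    then have "y \<in> chart_image s (\<Sigma> i)" "y \<in> chart_image s (\<Sigma> i')" using p i by auto
    then obtain x x' where "x \<in> \<Sigma> i" "x' \<in> \<Sigma> i'" "s x = Some y" "s x' = Some y"
      by (auto simp: chart_image_iff)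
    then show "i = i'" using charts_inj[OF s(1)] part_unique[OF i(1,2)] by metis
  qed
  have "q ` {..<n} \<subseteq> {..<n}" using p by (auto simp: q_def)
  then have "bij_betw q {..<n} {..<n}" using inj by (simp add: bij_betw_def endo_inj_surj)
  then have "q permutes {..<n}" by (rule bij_imp_permutes) (simp add: q_def)
  moreover have "rho X n \<Sigma> s \<subseteq> {(i, q i) | i. i < n}"
  proof (rule subrelI)
    fix i j assume "(i, j) \<in> rho X n \<Sigma> s"
    then have ij: "i < n" "j < n" "infinite {y \<in> \<Sigma> j. \<exists>x\<in>\<Sigma> i. s x = Some y}"
      using rho_iff[OF s(1)] by auto
    then obtain y where "y \<in> \<Sigma> j" "\<exists>x\<in>\<Sigma> i. s x = Some y"
      using infinite_imp_nonempty by blast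
    then have "y \<in> \<Sigma> (p i)" using p[OF ij(1)] by (auto simp: chart_image_iff[symmetric])
    then have "j = p i" using part_unique[OF ij(2) _ \<open>y \<in> \<Sigma> j\<close>] p[OF ij(1)] by blast
    then show "(i, j) \<in> {(i, q i) | i. i < n}" using ij(1) by (simp add: q_def)
  qed
  ultimately show "s \<in> A_part X n \<Sigma>" using A_part_if_rho_subset s(1) by blast
qed

lemma A_part_subset: "A_part X n \<Sigma> \<subseteq> charts X"
  by (auto simp: A_part_def)

text \<open>Inverting a chart transposes \<open>rho\<close>, which exchanges domain and range and
  preserves graphs of permutations. Facts about \<open>A_part_inv\<close> are then obtained from
  \<open>A_part\<close>.\<close>

lemma A_part_inv_eq: "A_part_inv X n \<Sigma> = chart_inv ` A_part X n \<Sigma>"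
proof (rule Set.set_eqI)
  fix f
  show "f \<in> A_part_inv X n \<Sigma> \<longleftrightarrow> f \<in> chart_inv ` A_part X n \<Sigma>"
  proof (cases "f \<in> charts X")
    case True
    then have "f \<in> chart_inv ` A_part X n \<Sigma> \<longleftrightarrow> chart_inv f \<in> A_part X n \<Sigma>"
      using inv_image_mem_iff[OF A_part_subset] by blast
    moreover have "perm_graph n ((rho X n \<Sigma> f)\<inverse>) \<longleftrightarrow> perm_graph n (rho X n \<Sigma> f)"
      using perm_graph_converse by (metis converse_converse)
    ultimately show ?thesis
      using True by (simp add: A_part_def A_part_inv_def rho_inv chart_inv_charts)
  next
    case False
    then show ?thesis using A_part_subset chart_inv_charts by (auto simp: A_part_inv_def)
  qed
qed

text \<open>By \<open>rho_comp\<close>, an empty row of \<open>rho f\<close> stays empty in the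
  product. If \<open>rho f\<close> is the graph of \<open>p\<close>, an empty row \<open>j\<close>
  of \<open>rho g\<close> empties the row that \<open>p\<close> sends to \<open>j\<close>. If both
  are graphs of permutations, the product relation lies in the graph of the composite.\<close>

lemma subsemigroup_A_part: "subsemigroup (A_part X n \<Sigma>) (sym_inv_monoid X)"
  unfolding subsemigroup_sym_inv_monoid
proof (intro conjI ballI A_part_subset)
  fix f g assume f: "f \<in> A_part X n \<Sigma>" and g: "g \<in> A_part X n \<Sigma>"
  then have fg: "f \<in> charts X" "g \<in> charts X" using A_part_subset by auto
  note sub = rho_comp[OF fg] and comp = charts_comp[OF fg]
  show "g \<circ>\<^sub>m f \<in> A_part X n \<Sigma>"
  proof (cases "Domain (rho X n \<Sigma> f) = {..<n}")
    case False
    then obtain i where "i < n" "i \<notin> Domain (rho X n \<Sigma> f)" using Domain_rho_subset by blast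
    then have "i \<notin> Domain (rho X n \<Sigma> (g \<circ>\<^sub>m f))" using sub by blast
    then show ?thesis using \<open>i < n\<close> comp by (auto simp: A_part_def)
  next
    case True
    then obtain p where p: "p permutes {..<n}" "rho X n \<Sigma> f = {(i, p i) | i. i < n}"
      using f by (auto simp: A_part_def perm_graph_def)
    show ?thesis
    proof (cases "Domain (rho X n \<Sigma> g) = {..<n}")
      case False
      then obtain j where j: "j < n" "j \<notin> Domain (rho X n \<Sigma> g)" using Domain_rho_subset by blast
      then have "j \<in> p ` {..<n}" using permutes_image[OF p(1)] by simp
      then obtain i where i: "i < n" "j = p i" by auto
      then have "i \<notin> Domain (rho X n \<Sigma> (g \<circ>\<^sub>m f))" using sub j p(2) by auto
      then show ?thesis using \<open>i < n\<close> comp by (auto simp: A_part_def)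
    next
      case True
      then obtain q where q: "q permutes {..<n}" "rho X n \<Sigma> g = {(i, q i) | i. i < n}"
        using g by (auto simp: A_part_def perm_graph_def)
      have "rho X n \<Sigma> (g \<circ>\<^sub>m f) \<subseteq> {(i, (q \<circ> p) i) | i. i < n}" using sub p(2) q(2) by auto
      then show ?thesis using A_part_if_rho_subset comp permutes_compose[OF p(1) q(1)] by blast
    qed
  qed
qed

end

section \<open>Factoring a sparse chart\<close>

context infinite_partition
begin

text \<open>Every point of \<open>D\<close> gets its own target in the set \<open>P i\<close> of its
  part. The complement of \<open>D\<close> and the choice of targets both leave infinitely many
  points in each part, so the assignment extends to a stabiliser element.\<close>

lemma Stab_place:
  assumes D: "D \<subseteq> X" "\<And>i. i < n \<Longrightarrow> infinite (\<Sigma> i - D)"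
    and P: "\<And>i. i < n \<Longrightarrow> P i \<subseteq> \<Sigma> i" "\<And>i. i < n \<Longrightarrow> infinite (P i)"
  obtains s where "s \<in> Stab X n \<Sigma>"
    "\<And>i x. i < n \<Longrightarrow> x \<in> \<Sigma> i \<Longrightarrow> x \<in> D \<Longrightarrow> \<exists>z\<in>P i. s x = Some z"
proof -
  let ?B = "\<lambda>x. {z. \<exists>i<n. x \<in> \<Sigma> i \<and> z \<in> P i}"
  have B: "?B x = P i" if "i < n" "x \<in> \<Sigma> i" for i x
    using that part_unique by blast
  obtain t where t: "inj_on t D" "\<And>x. x \<in> D \<Longrightarrow> t x \<in> ?B x"
    "\<And>k. k \<in> {..<n} \<Longrightarrow> infinite (\<Sigma> k - t ` D)"
  proof (rule infinite_distinct_choice_sparse[of D "{..<n}" ?B \<Sigma>])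
    show "countable D" using D(1) countable countable_subset by blast
    fix x assume "x \<in> D"
    then obtain i where i: "i < n" "x \<in> \<Sigma> i" using D(1) part_ex by blast
    show "infinite (?B x)" unfolding B[OF i] using P(2)[OF i(1)] .
  qed (use infinite_part that in auto)
  have tP: "t x \<in> P i" if "i < n" "x \<in> \<Sigma> i" "x \<in> D" for i x
    using t(2)[OF that(3)] unfolding B[OF that(1,2)] .
  obtain \<psi> where \<psi>: "\<psi> \<in> charts X" "\<And>x y. \<psi> x = Some y \<longleftrightarrow> x \<in> D \<and> y = t x"
  proof (rule chart_of_relation[of "\<lambda>x y. x \<in> D \<and> y = t x" X])
    fix x y assume xy: "x \<in> D \<and> y = t x"
    then obtain i where i: "i < n" "x \<in> \<Sigma> i" using D(1) part_ex by blast
    then show "x \<in> X \<and> y \<in> X"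
      using xy D(1) tP[OF i] subsetD[OF P(1)[OF i(1)]] subsetD[OF part_subset[OF i(1)]] by blast
  next
    show "\<And>x y z. x \<in> D \<and> z = t x \<Longrightarrow> y \<in> D \<and> z = t y \<Longrightarrow> x = y"
      using t(1) by (auto simp: inj_on_def)
  qed (auto intro: that)
  have dom_ran: "dom \<psi> = D" "ran \<psi> = t ` D" by (auto simp: dom_def ran_def \<psi>(2))
  obtain s where s: "s \<in> Stab X n \<Sigma>" "\<And>x y. \<psi> x = Some y \<Longrightarrow> s x = Some y"
  proof (rule extend_to_Stab[OF \<psi>(1) permutes_id])
    show "\<And>i x y. i < n \<Longrightarrow> x \<in> \<Sigma> i \<Longrightarrow> \<psi> x = Some y \<Longrightarrow> y \<in> \<Sigma> (id i)"
      using tP P(1) by (auto simp: \<psi>(2))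
  qed (use D(2) t(3) that in \<open>auto simp: dom_ran\<close>)
  have "\<exists>z\<in>P i. s x = Some z" if "i < n" "x \<in> \<Sigma> i" "x \<in> D" for i x
    using tP[OF that] s(2)[of x "t x"] that(3) by (auto simp: \<psi>(2))
  with s(1) show ?thesis by (rule that)
qed

text \<open>The factor \<open>a\<close> moves \<open>dom \<phi>\<close> to points that
  \<open>h\<close> gathers in part \<open>q\<close>, \<open>g\<close> distributes points of part
  \<open>r\<close> over all parts, and \<open>b\<close> exchanges parts \<open>q\<close> and
  \<open>r\<close> so as to connect the right points. The last factor carries the outcome to
  \<open>ran \<phi>\<close>.\<close>

lemma sparse_chart_factorization:
  assumes \<phi>: "\<phi> \<in> charts X" and h: "h \<in> charts X" and g: "g \<in> charts X"
    and \<phi>_sparse: "\<And>i. i < n \<Longrightarrow> infinite (\<Sigma> i - dom \<phi>)" "\<And>i. i < n \<Longrightarrow> infinite (\<Sigma> i - ran \<phi>)"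
    and q: "q < n" "\<And>i. i < n \<Longrightarrow> (i, q) \<in> rho X n \<Sigma> h" "\<And>i. i < n \<Longrightarrow> infinite (\<Sigma> i - ran h)"
    and r: "r < n" "\<And>i. i < n \<Longrightarrow> (r, i) \<in> rho X n \<Sigma> g" "\<And>i. i < n \<Longrightarrow> infinite (\<Sigma> i - dom g)"
  obtains a b c where "a \<in> Stab X n \<Sigma>" "b \<in> Stab X n \<Sigma>" "c \<in> Stab X n \<Sigma>"
    "\<phi> = c \<circ>\<^sub>m (g \<circ>\<^sub>m (b \<circ>\<^sub>m (h \<circ>\<^sub>m a)))"
proof -
  have \<phi>X: "dom \<phi> \<subseteq> X" "ran \<phi> \<subseteq> X" using \<phi> by (auto simp: charts_def)
  let ?P = "\<lambda>i. {z \<in> \<Sigma> i. \<exists>y\<in>\<Sigma> q. h z = Some y}"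
  obtain a where a: "a \<in> Stab X n \<Sigma>"
    "\<And>i x. i < n \<Longrightarrow> x \<in> \<Sigma> i \<Longrightarrow> x \<in> dom \<phi> \<Longrightarrow> \<exists>z\<in>?P i. a x = Some z"
  proof (rule Stab_place[of "dom \<phi>" ?P])
    show "\<And>i. i < n \<Longrightarrow> infinite (?P i)" using q(2) rho_iff'[OF h] by blast
  qed (use \<phi>X \<phi>_sparse that in auto)
  let ?Q = "\<lambda>i. {z \<in> \<Sigma> i. \<exists>y\<in>\<Sigma> r. g y = Some z}"
  \<comment> \<open>This \<open>c\<close> leads from \<open>ran \<phi>\<close> to points that
    \<open>g\<close> reaches from part \<open>r\<close>; its inverse becomes the last
    factor.\<close>
  obtain c where c: "c \<in> Stab X n \<Sigma>"
    "\<And>i x. i < n \<Longrightarrow> x \<in> \<Sigma> i \<Longrightarrow> x \<in> ran \<phi> \<Longrightarrow> \<exists>z\<in>?Q i. c x = Some z"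
  proof (rule Stab_place[of "ran \<phi>" ?Q])
    show "\<And>i. i < n \<Longrightarrow> infinite (?Q i)" using r(2) rho_iff[OF g] by blast
  qed (use \<phi>X \<phi>_sparse that in auto)
  have ac: "a \<in> charts X" "c \<in> charts X" using a c Stab_charts by auto
  define \<sigma> where "\<sigma> = transpose q r"
  have \<sigma>: "\<sigma> permutes {..<n}" unfolding \<sigma>_def using q(1) r(1) by (intro permutes_swap_id) auto
  have \<sigma>n: "\<sigma> i < n" if "i < n" for i using permutes_in_image[OF \<sigma>] that by auto
  \<comment> \<open>\<open>b\<close> must map \<open>x\<close> to \<open>y\<close> whenever \<open>M x y\<close>; the other points of \<open>ran h\<close> are sent outside
    \<open>dom g\<close>, so that the product is undefined outside \<open>dom \<phi>\<close>.\<close>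
  define E where "E x \<longleftrightarrow> (\<exists>u w v. \<phi> u = Some w \<and> a u = Some v \<and> h v = Some x)" for x
  define M where "M x y \<longleftrightarrow> (\<exists>u w v z. \<phi> u = Some w \<and> a u = Some v \<and> h v = Some x
    \<and> c w = Some z \<and> g y = Some z)" for x y
  have ME: "M x y \<Longrightarrow> E x" for x y by (auto simp: M_def E_def)
  have M: "\<exists>v y. a u = Some v \<and> h v = Some y \<and> y \<in> \<Sigma> q" if uw: "\<phi> u = Some w" for u w
  proof -
    have "u \<in> dom \<phi>" using uw by blast
    moreover obtain i where "i < n" "u \<in> \<Sigma> i" using charts_mem[OF \<phi> uw] part_ex by blast
    ultimately show ?thesis using a(2) by blast
  qed
  have N: "\<exists>z y. c w = Some z \<and> g y = Some z \<and> y \<in> \<Sigma> r" if uw: "\<phi> u = Some w" for u w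
  proof -
    have "w \<in> ran \<phi>" using uw by (auto simp: ran_def)
    moreover obtain i where "i < n" "w \<in> \<Sigma> i" using charts_mem[OF \<phi> uw] part_ex by blast
    ultimately show ?thesis using c(2) by blast
  qed
  have M_parts: "x \<in> \<Sigma> q" "y \<in> \<Sigma> r" if xy: "M x y" for x y
  proof -
    obtain u w v z where *: "\<phi> u = Some w" "a u = Some v" "h v = Some x" "c w = Some z" "g y = Some z"
      using xy by (auto simp: M_def)
    show "x \<in> \<Sigma> q" using M[OF *(1)] *(2,3) by auto
    show "y \<in> \<Sigma> r" using N[OF *(1)] *(4,5) charts_inj[OF g] by fastforce
  qed
  have M_fun: "y = y'" if "M x y" "M x y'" for x y y'
  proof -
    obtain u w v z where *: "\<phi> u = Some w" "a u = Some v" "h v = Some x" "c w = Some z" "g y = Some z"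
      using \<open>M x y\<close> by (auto simp: M_def)
    obtain u' w' v' z' where **: "\<phi> u' = Some w'" "a u' = Some v'" "h v' = Some x"
      "c w' = Some z'" "g y' = Some z'"
      using \<open>M x y'\<close> by (auto simp: M_def)
    have "v = v'" using charts_inj[OF h *(3) **(3)] .
    then have "u = u'" using charts_inj[OF ac(1)] *(2) **(2) by blast
    then have "z = z'" using * ** by simp
    then show ?thesis using charts_inj[OF g] * ** by blast
  qed
  have M_inj: "x = x'" if "M x y" "M x' y" for x x' y
  proof -
    obtain u w v z where *: "\<phi> u = Some w" "a u = Some v" "h v = Some x" "c w = Some z" "g y = Some z"
      using \<open>M x y\<close> by (auto simp: M_def)
    obtain u' w' v' z' where **: "\<phi> u' = Some w'" "a u' = Some v'" "h v' = Some x'"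
      "c w' = Some z'" "g y = Some z'"
      using \<open>M x' y\<close> by (auto simp: M_def)
    have "z = z'" using * ** by simp
    then have "w = w'" using charts_inj[OF ac(2)] *(4) **(4) by blast
    then have "u = u'" using charts_inj[OF \<phi>] *(1) **(1) by blast
    then show ?thesis using * ** by simp
  qed
  let ?B = "\<lambda>x. {y. \<exists>i<n. x \<in> \<Sigma> i \<and> y \<in> \<Sigma> (\<sigma> i) - dom g}"
  have B: "?B x = \<Sigma> (\<sigma> i) - dom g" if "i < n" "x \<in> \<Sigma> i" for i x
    using that part_unique by blast
  have hX: "ran h \<subseteq> X" using h by (auto simp: charts_def)
  obtain t where t: "inj_on t (ran h)" "\<And>x. x \<in> ran h \<Longrightarrow> t x \<in> ?B x"
    "\<And>k. k \<in> {..<n} \<Longrightarrow> infinite (\<Sigma> k - dom g - t ` ran h)"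
  proof (rule infinite_distinct_choice_sparse[of "ran h" "{..<n}" ?B "\<lambda>k. \<Sigma> k - dom g"])
    show "countable (ran h)" using hX countable countable_subset by blast
    fix x assume "x \<in> ran h"
    then obtain i where i: "i < n" "x \<in> \<Sigma> i" using hX part_ex by blast
    show "infinite (?B x)" unfolding B[OF i] using r(3)[OF \<sigma>n[OF i(1)]] .
  qed (use r(3) that in auto)
  have t_part: "t x \<in> \<Sigma> (\<sigma> i) - dom g" if "i < n" "x \<in> \<Sigma> i" "x \<in> ran h" for i x
    using t(2)[OF that(3)] unfolding B[OF that(1,2)] .
  have t_dom: "t x \<notin> dom g" "t x \<in> X" if x: "x \<in> ran h" for x
  proof -
    obtain i where i: "i < n" "x \<in> \<Sigma> i" using x hX part_ex by blast
    show "t x \<notin> dom g" "t x \<in> X"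
      using t_part[OF i x] part_subset[OF \<sigma>n[OF i(1)]] by auto
  qed
  \<comment> \<open>The two clauses cannot clash: their sources are separated by \<open>E\<close>,
    their targets by \<open>dom g\<close>.\<close>
  let ?R = "\<lambda>x y. M x y \<or> x \<in> ran h \<and> \<not> E x \<and> y = t x"
  have M_dom: "y \<in> dom g" if "M x y" for x y using that by (auto simp: M_def)
  have M_ran: "x \<in> ran h" if "M x y" for x y using that by (auto simp: M_def ran_def)
  obtain \<psi> where \<psi>: "\<psi> \<in> charts X" "\<And>x y. \<psi> x = Some y \<longleftrightarrow> ?R x y"
  proof (rule chart_of_relation[of ?R X])
    show "\<And>x y. ?R x y \<Longrightarrow> x \<in> X \<and> y \<in> X"
      using M_parts q(1) r(1) part_subset hX t_dom(2) by blast
    show "\<And>x y z. ?R x y \<Longrightarrow> ?R x z \<Longrightarrow> y = z" using ME M_fun by blast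
    fix x y z assume "?R x z" "?R y z"
    then consider "M x z" "M y z" | "M x z" "y \<in> ran h" "z = t y" | "M y z" "x \<in> ran h" "z = t x"
      | "x \<in> ran h" "y \<in> ran h" "t x = t y" by blast
    then show "x = y"
    proof cases
      case 1 then show ?thesis by (rule M_inj)
    next
      case 2 then show ?thesis using M_dom t_dom by blast
    next
      case 3 then show ?thesis using M_dom t_dom by blast
    next
      case 4 then show ?thesis using t(1) by (auto simp: inj_on_def)
    qed
  qed (rule that)
  have dom: "dom \<psi> \<subseteq> ran h" by (auto simp: \<psi>(2) M_ran)
  have ran: "ran \<psi> \<subseteq> dom g \<union> t ` ran h" using M_dom by (auto simp: ran_def \<psi>(2))
  obtain b where b: "b \<in> Stab X n \<Sigma>" "\<And>x y. \<psi> x = Some y \<Longrightarrow> b x = Some y"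
  proof (rule extend_to_Stab[OF \<psi>(1) \<sigma>])
    fix i x y assume i: "i < n" "x \<in> \<Sigma> i" and "\<psi> x = Some y"
    then have "?R x y" using \<psi>(2) by blast
    then show "y \<in> \<Sigma> (\<sigma> i)"
    proof
      assume xy: "M x y"
      then have "i = q" using M_parts(1) i q(1) part_unique by blast
      then show ?thesis using M_parts(2)[OF xy] by (simp add: \<sigma>_def)
    qed (use t_part i in blast)
  next
    show "infinite (\<Sigma> i - dom \<psi>)" if "i < n" for i
      using q(3)[OF that] dom finite_subset[of "\<Sigma> i - ran h" "\<Sigma> i - dom \<psi>"] by blast
    show "infinite (\<Sigma> i - ran \<psi>)" if "i < n" for i
      using t(3)[of i] that ran finite_subset[of "\<Sigma> i - dom g - t ` ran h" "\<Sigma> i - ran \<psi>"] by blast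
  qed (rule that)
  have "\<phi> = chart_inv c \<circ>\<^sub>m (g \<circ>\<^sub>m (b \<circ>\<^sub>m (h \<circ>\<^sub>m a)))"
  proof (rule map_eqI_Some)
    fix u w
    have "(chart_inv c \<circ>\<^sub>m (g \<circ>\<^sub>m (b \<circ>\<^sub>m (h \<circ>\<^sub>m a)))) u = Some w \<longleftrightarrow>
        (\<exists>v x y z. a u = Some v \<and> h v = Some x \<and> b x = Some y \<and> g y = Some z \<and> c w = Some z)"
      (is "_ \<longleftrightarrow> ?rhs") by (auto simp: map_comp_Some_iff chart_inv_Some[OF ac(2)])
    also have "?rhs \<longleftrightarrow> \<phi> u = Some w"
    proof
      assume uw: "\<phi> u = Some w"
      obtain v x where v: "a u = Some v" "h v = Some x" using M[OF uw] by blast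
      obtain z y where z: "c w = Some z" "g y = Some z" using N[OF uw] by blast
      have "M x y" using uw v z by (auto simp: M_def)
      then have "b x = Some y" using b(2) \<psi>(2) by blast
      then show ?rhs using v z by blast
    next
      assume ?rhs
      then obtain v x y z where *: "a u = Some v" "h v = Some x" "b x = Some y" "g y = Some z"
        "c w = Some z" by blast
      have xh: "x \<in> ran h" using *(2) by (auto simp: ran_def)
      have "E x"
      proof (rule ccontr)
        assume "\<not> E x"
        then have "b x = Some (t x)" using b(2) \<psi>(2) xh by blast
        then show False using * t_dom(1)[OF xh] by auto
      qed
      \<comment> \<open>The point \<open>u'\<close> witnessing \<open>E x\<close> turns out to be
        \<open>u\<close>, by injectivity of \<open>h\<close> and \<open>a\<close>; likewise
        \<open>w'\<close> is \<open>w\<close>, by single-valuedness of \<open>b\<close> and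
        \<open>g\<close> and injectivity of \<open>c\<close>.\<close>
      then obtain u' w' v' where **: "\<phi> u' = Some w'" "a u' = Some v'" "h v' = Some x"
        by (auto simp: E_def)
      then obtain z' y' where z: "c w' = Some z'" "g y' = Some z'" using N by blast
      have "M x y'" using ** z by (auto simp: M_def)
      then have "b x = Some y'" using b(2) \<psi>(2) by blast
      then have "z = z'" using * z by simp
      then have "w' = w" using charts_inj[OF ac(2)] z * by blast
      moreover have "v = v'" using charts_inj[OF h] * ** by blast
      then have "u' = u" using charts_inj[OF ac(1)] * ** by blast
      ultimately show "\<phi> u = Some w" using ** by simp
    qed
    finally show "\<phi> u = Some w \<longleftrightarrow> (chart_inv c \<circ>\<^sub>m (g \<circ>\<^sub>m (b \<circ>\<^sub>m (h \<circ>\<^sub>m a)))) u = Some w" by simp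
  qed
  then show ?thesis using that a(1) b(1) Stab_inv[OF c(1)] by blast
qed

end

subsection \<open>Subsemigroups containing the stabiliser\<close>

locale Stab_subsemigroup = infinite_partition +
  fixes T :: "('a \<rightharpoonup> 'a) set"
  assumes subsemigroup: "subsemigroup T (sym_inv_monoid X)"
    and Stab_subset: "Stab X n \<Sigma> \<subseteq> T"
begin

lemma T_charts: "f \<in> T \<Longrightarrow> f \<in> charts X"
  using subsemigroup by (auto simp: subsemigroup_sym_inv_monoid)

lemma T_comp: "f \<in> T \<Longrightarrow> g \<in> T \<Longrightarrow> g \<circ>\<^sub>m f \<in> T"
  using subsemigroup by (auto simp: subsemigroup_sym_inv_monoid)

lemma T_comp_Stab: "f \<in> T \<Longrightarrow> g \<in> T \<Longrightarrow> s \<in> Stab X n \<Sigma> \<Longrightarrow> g \<circ>\<^sub>m (s \<circ>\<^sub>m f) \<in> T"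
  using T_comp Stab_subset by blast

text \<open>As the stabiliser is closed under inverses, the inverted semigroup satisfies the same
  assumptions. Each result about \<open>T\<close> therefore has a dual.\<close>

lemma Stab_subsemigroup_inv_image: "Stab_subsemigroup X n \<Sigma> (chart_inv ` T)"
proof (unfold_locales)
  show "subsemigroup (chart_inv ` T) (sym_inv_monoid X)"
    using subsemigroup by (rule subsemigroup_inv_image)
  have "chart_inv (chart_inv s) \<in> chart_inv ` T" if "s \<in> Stab X n \<Sigma>" for s
    using that Stab_inv Stab_subset by blast
  then show "Stab X n \<Sigma> \<subseteq> chart_inv ` T" using Stab_charts by fastforce
qed

lemma Stab_dom: "s \<in> Stab X n \<Sigma> \<Longrightarrow> dom s = X"
  by (simp add: Stab_def sym_perms_def)

text \<open>Induction on the number \<open>m\<close> of parts already missed infinitely often. If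
  \<open>ran f\<close> omits only finitely many points of part \<open>m\<close>, then
  \<open>f\<close> is replaced by \<open>f s f\<close>, where \<open>s\<close> sends infinitely many
  points outside \<open>ran f\<close> to points that \<open>f\<close> maps into part
  \<open>m\<close>. Their images leave the range, and the points already missed stay missed because
  the range only shrinks.\<close>

lemma ex_sparse_total:
  assumes u: "u \<in> T" "dom u = X" "infinite (X - ran u)"
  obtains f where "f \<in> T" "dom f = X" "\<And>k. k < n \<Longrightarrow> infinite (\<Sigma> k - ran f)"
proof -
  have "\<exists>f\<in>T. dom f = X \<and> infinite (X - ran f) \<and> (\<forall>k<m. infinite (\<Sigma> k - ran f))" if "m \<le> n" for m
    using that
  proof (induction m)
    case 0
    then show ?case using u by blast
  next
    case (Suc m)
    then obtain f where f: "f \<in> T" "dom f = X" "infinite (X - ran f)"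
      "\<And>k. k < m \<Longrightarrow> infinite (\<Sigma> k - ran f)" by auto
    have fc: "f \<in> charts X" using f(1) T_charts by blast
    have m: "m < n" using Suc by simp
    show ?case
    proof (cases "infinite (\<Sigma> m - ran f)")
      case True
      then have "\<forall>k<Suc m. infinite (\<Sigma> k - ran f)" using f(4) by (metis less_Suc_eq)
      then show ?thesis using f(1,2,3) by blast
    next
      case False
      then have "infinite (\<Sigma> m \<inter> ran f)" using infinite_part[OF m] by (metis Un_Diff_Int finite_Un)
      then have "infinite {x. \<exists>y\<in>\<Sigma> m \<inter> ran f. f x = Some y}"
        by (rule infinite_chart_preimage[OF fc]) blast
      moreover have "{x. \<exists>y\<in>\<Sigma> m \<inter> ran f. f x = Some y} \<subseteq> X" using charts_mem[OF fc] by blast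
      ultimately obtain i where i: "i < n" "infinite ({x. \<exists>y\<in>\<Sigma> m \<inter> ran f. f x = Some y} \<inter> \<Sigma> i)"
        (is "infinite ?B") by (rule pigeonhole_part)
      obtain j where j: "j < n" "infinite ((X - ran f) \<inter> \<Sigma> j)" (is "infinite ?A")
        using f(3) pigeonhole_part[of "X - ran f"] by blast
      have tr: "transpose j i permutes {..<n}" using i j by (intro permutes_swap_id) auto
      obtain s where s: "s \<in> Stab X n \<Sigma>" "infinite {y \<in> ?B. \<exists>x\<in>?A. s x = Some y}" (is "infinite ?S")
        using Stab_infinite_meets[OF tr, of "{()}" "\<lambda>_. j" "\<lambda>_. ?A" "\<lambda>_. ?B"] i j by auto
      let ?g = "f \<circ>\<^sub>m (s \<circ>\<^sub>m f)"
      have gT: "?g \<in> T" using T_comp_Stab f(1) s(1) by blast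
      have dom: "dom ?g = X"
        using dom_total_comp[OF charts_comp[OF fc Stab_charts[OF s(1)]]
            dom_total_comp[OF fc f(2) Stab_dom[OF s(1)]] f(2)] .
      have ran: "ran ?g \<subseteq> ran f" by (rule ran_comp_subset)
      have "infinite {z. \<exists>y\<in>?S. f y = Some z}" by (rule infinite_chart_image[OF fc s(2)]) auto
      moreover have "{z. \<exists>y\<in>?S. f y = Some z} \<subseteq> \<Sigma> m - ran ?g"
      proof
        fix z assume "z \<in> {z. \<exists>y\<in>?S. f y = Some z}"
        then obtain x y where *: "f y = Some z" "z \<in> \<Sigma> m" "x \<notin> ran f" "s x = Some y" by auto
        have "z \<notin> ran ?g"
        proof
          assume "z \<in> ran ?g"
          then obtain w x' y' where "f w = Some x'" "s x' = Some y'" "f y' = Some z"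
            by (auto simp: ran_def map_comp_Some_iff)
          then have "x' = x" using charts_inj[OF fc] charts_inj[OF Stab_charts[OF s(1)]] * by metis
          then show False using \<open>f w = Some x'\<close> *(3) by (auto simp: ran_def)
        qed
        with *(2) show "z \<in> \<Sigma> m - ran ?g" by blast
      qed
      ultimately have new: "infinite (\<Sigma> m - ran ?g)" using finite_subset by blast
      have old: "infinite (\<Sigma> k - ran ?g)" if "k < m" for k
        using f(4)[OF that] finite_subset[of "\<Sigma> k - ran f" "\<Sigma> k - ran ?g"] ran by blast
      have "infinite (X - ran ?g)"
        using f(3) finite_subset[of "X - ran f" "X - ran ?g"] ran by blast
      moreover have "\<forall>k<Suc m. infinite (\<Sigma> k - ran ?g)"
        using new old by (metis less_Suc_eq)
      ultimately show ?thesis using gT dom by (intro bexI[of _ ?g] conjI)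
    qed
  qed
  then show ?thesis using that by blast
qed

text \<open>Since \<open>rho f\<close> is total without being the graph of a permutation, it has a
  collision of \<open>i1\<close> and \<open>i2\<close> at \<open>p\<close>. Rows are merged one at a
  time: if the first \<open>m\<close> rows share column \<open>q\<close> while row \<open>m\<close>
  has \<open>k\<close>, a permutation taking \<open>q\<close> to \<open>i1\<close> and
  \<open>k\<close> to \<open>i2\<close>, followed by \<open>f\<close>, gives all of them column
  \<open>p\<close>. Totality is kept and supplies an entry for the next row.\<close>

lemma ex_full_column:
  assumes f: "f \<in> T" "f \<notin> A_part X n \<Sigma>"
  obtains h q where "h \<in> T" "q < n" "\<And>i. i < n \<Longrightarrow> (i, q) \<in> rho X n \<Sigma> h"
proof -
  have fc: "f \<in> charts X" using f(1) T_charts by blast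
  have tot: "Domain (rho X n \<Sigma> f) = {..<n}" and "\<not> perm_graph n (rho X n \<Sigma> f)"
    using f(2) fc by (auto simp: A_part_def)
  then obtain i1 i2 p where coll: "i1 \<noteq> i2" "(i1, p) \<in> rho X n \<Sigma> f" "(i2, p) \<in> rho X n \<Sigma> f"
    using total_not_perm_graph_collision[OF rho_subset] by metis
  then have lt: "i1 < n" "i2 < n" "p < n" using rho_subset by blast+
  have "\<exists>h\<in>T. Domain (rho X n \<Sigma> h) = {..<n} \<and> (\<exists>q<n. \<forall>i<m. (i, q) \<in> rho X n \<Sigma> h)" if "m \<le> n" for m
    using that
  proof (induction m)
    case 0
    then show ?case using f(1) tot lt by blast
  next
    case (Suc m)
    then obtain h q where h: "h \<in> T" "Domain (rho X n \<Sigma> h) = {..<n}" "q < n"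
      "\<And>i. i < m \<Longrightarrow> (i, q) \<in> rho X n \<Sigma> h" by auto
    have hc: "h \<in> charts X" using h(1) T_charts by blast
    have "m \<in> Domain (rho X n \<Sigma> h)" using Suc h(2) by simp
    then obtain k where k: "(m, k) \<in> rho X n \<Sigma> h" by blast
    then have kn: "k < n" using rho_subset by blast
    show ?case
    proof (cases "k = q")
      case True
      then have "\<forall>i<Suc m. (i, q) \<in> rho X n \<Sigma> h" using h(4) k by (metis less_Suc_eq)
      then show ?thesis using h(1,2,3) by blast
    next
      case False
      then obtain \<sigma> where \<sigma>: "\<sigma> permutes {..<n}" "\<sigma> q = i1" "\<sigma> k = i2"
        using ex_permutes_two[OF h(3) kn lt(1,2)] coll(1) by metis
      obtain s where s: "s \<in> Stab X n \<Sigma>"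
        "\<And>i j k. (i, j) \<in> rho X n \<Sigma> h \<Longrightarrow> (\<sigma> j, k) \<in> rho X n \<Sigma> f \<Longrightarrow>
          (i, k) \<in> rho X n \<Sigma> (f \<circ>\<^sub>m (s \<circ>\<^sub>m h))"
        using rho_comp_Stab[OF hc fc \<sigma>(1)] by blast
      let ?g = "f \<circ>\<^sub>m (s \<circ>\<^sub>m h)"
      have "?g \<in> T" using T_comp_Stab h(1) f(1) s(1) by blast
      moreover have "Domain (rho X n \<Sigma> ?g) = {..<n}"
      proof
        show "{..<n} \<subseteq> Domain (rho X n \<Sigma> ?g)"
        proof
          fix i assume "i \<in> {..<n}"
          then obtain j where j: "(i, j) \<in> rho X n \<Sigma> h" using h(2) by blast
          then have "\<sigma> j \<in> Domain (rho X n \<Sigma> f)"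
            using rho_subset permutes_in_image[OF \<sigma>(1)] tot by blast
          then show "i \<in> Domain (rho X n \<Sigma> ?g)" using s(2)[OF j] by blast
        qed
      qed (rule Domain_rho_subset)
      moreover have "(i, p) \<in> rho X n \<Sigma> ?g" if "i < Suc m" for i
      proof (cases "i = m")
        case True
        then show ?thesis using s(2)[OF k] \<sigma>(3) coll(3) by simp
      next
        case False
        then show ?thesis using s(2)[OF h(4)] \<sigma>(2) coll(2) that by simp
      qed
      ultimately show ?thesis using lt(3) by blast
    qed
  qed
  then show ?thesis using that by blast
qed

text \<open>A sparse total element \<open>x\<close> is appended to \<open>h\<close>. The range of
  the product lies in \<open>ran x\<close>, and the nonempty row \<open>q\<close> of
  \<open>rho x\<close> turns the full column \<open>q\<close> into a full column
  \<open>k\<close>.\<close>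

lemma ex_sparse_full_column:
  assumes u: "u \<in> T" "dom u = X" "infinite (X - ran u)"
    and f: "f \<in> T" "f \<notin> A_part X n \<Sigma>"
  obtains h q where "h \<in> T" "q < n" "\<And>i. i < n \<Longrightarrow> (i, q) \<in> rho X n \<Sigma> h"
    "\<And>k. k < n \<Longrightarrow> infinite (\<Sigma> k - ran h)"
proof -
  obtain x where x: "x \<in> T" "dom x = X" "\<And>k. k < n \<Longrightarrow> infinite (\<Sigma> k - ran x)"
    using ex_sparse_total[OF u] by metis
  obtain h q where h: "h \<in> T" "q < n" "\<And>i. i < n \<Longrightarrow> (i, q) \<in> rho X n \<Sigma> h"
    using ex_full_column[OF f] by metis
  have c: "x \<in> charts X" "h \<in> charts X" using x h T_charts by auto
  obtain s where s: "s \<in> Stab X n \<Sigma>"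
    "\<And>i j k. (i, j) \<in> rho X n \<Sigma> h \<Longrightarrow> (id j, k) \<in> rho X n \<Sigma> x \<Longrightarrow>
      (i, k) \<in> rho X n \<Sigma> (x \<circ>\<^sub>m (s \<circ>\<^sub>m h))"
    using rho_comp_Stab[OF c(2,1) permutes_id] by metis
  let ?g = "x \<circ>\<^sub>m (s \<circ>\<^sub>m h)"
  obtain k where k: "(q, k) \<in> rho X n \<Sigma> x" using Domain_rho[OF c(1) x(2)] h(2) by blast
  show ?thesis
  proof
    show "?g \<in> T" using T_comp_Stab h(1) x(1) s(1) by blast
    show "k < n" using k rho_subset by blast
    show "(i, k) \<in> rho X n \<Sigma> ?g" if "i < n" for i using s(2)[OF h(3)[OF that]] k by simp
    show "infinite (\<Sigma> k - ran ?g)" if "k < n" for k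
      using x(3)[OF that] finite_subset[of "\<Sigma> k - ran x" "\<Sigma> k - ran ?g"] ran_comp_subset[of x "s \<circ>\<^sub>m h"]
      by blast
  qed
qed

text \<open>The elements \<open>u\<close> and \<open>f\<close> give \<open>x\<close> and
  \<open>h\<close>; the same constructions in the inverted semigroup give \<open>y\<close> and
  \<open>k\<close> from \<open>v\<close> and \<open>g\<close>. The inverses of \<open>x\<close> and
  \<open>y\<close> may lie outside \<open>T\<close>: it is the sparse middle factor as a whole that
  is shown to belong to \<open>T\<close>.\<close>

lemma eq_charts:
  assumes u: "u \<in> T" "dom u = X" "infinite (X - ran u)"
    and v: "v \<in> T" "ran v = X" "infinite (X - dom v)"
    and f: "f \<in> T" "f \<notin> A_part X n \<Sigma>"
    and g: "g \<in> T" "g \<notin> A_part_inv X n \<Sigma>"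
  shows "T = charts X"
proof
  show "T \<subseteq> charts X" using T_charts by blast
  interpret inv: Stab_subsemigroup X n \<Sigma> "chart_inv ` T" by (rule Stab_subsemigroup_inv_image)
  have vc: "v \<in> charts X" and gc: "g \<in> charts X" using v g T_charts by auto
  have v': "chart_inv v \<in> chart_inv ` T" "dom (chart_inv v) = X" "infinite (X - ran (chart_inv v))"
    using v vc by auto
  have g': "chart_inv g \<in> chart_inv ` T" "chart_inv g \<notin> A_part X n \<Sigma>"
    using g inv_image_mem_iff[OF A_part_subset gc] by (auto simp: A_part_inv_eq)
  obtain x where x: "x \<in> T" "dom x = X" "\<And>k. k < n \<Longrightarrow> infinite (\<Sigma> k - ran x)"
    using ex_sparse_total[OF u] by metis
  obtain h q where h: "h \<in> T" "q < n" "\<And>i. i < n \<Longrightarrow> (i, q) \<in> rho X n \<Sigma> h"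
    "\<And>k. k < n \<Longrightarrow> infinite (\<Sigma> k - ran h)"
    using ex_sparse_full_column[OF u f] by metis
  obtain y' where y': "y' \<in> chart_inv ` T" "dom y' = X" "\<And>k. k < n \<Longrightarrow> infinite (\<Sigma> k - ran y')"
    using inv.ex_sparse_total[OF v'] by metis
  obtain k' r where k': "k' \<in> chart_inv ` T" "r < n" "\<And>i. i < n \<Longrightarrow> (i, r) \<in> rho X n \<Sigma> k'"
    "\<And>i. i < n \<Longrightarrow> infinite (\<Sigma> i - ran k')"
    using inv.ex_sparse_full_column[OF v' g'] by metis
  obtain y k where y: "y \<in> T" "y' = chart_inv y" and k: "k \<in> T" "k' = chart_inv k"
    using y'(1) k'(1) by blast
  have c: "x \<in> charts X" "h \<in> charts X" "y \<in> charts X" "k \<in> charts X"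
    using x h y k T_charts by auto
  have ydom: "ran y = X" "\<And>k. k < n \<Longrightarrow> infinite (\<Sigma> k - dom y)" using y' y c by auto
  have krho: "(r, i) \<in> rho X n \<Sigma> k" "infinite (\<Sigma> i - dom k)" if "i < n" for i
    using k'(3,4)[OF that] k c by (auto simp: rho_inv)
  show "charts X \<subseteq> T"
  proof
    fix \<phi> assume \<phi>: "\<phi> \<in> charts X"
    let ?\<psi> = "chart_inv y \<circ>\<^sub>m (\<phi> \<circ>\<^sub>m chart_inv x)"
    have \<psi>c: "?\<psi> \<in> charts X"
      by (intro charts_comp chart_inv_charts \<phi> c)
    have dom: "dom ?\<psi> \<subseteq> ran x"
      using c(1) by (auto simp: map_comp_Some_iff chart_inv_Some ran_def)
    have ran: "ran ?\<psi> \<subseteq> dom y"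
      using c(3) by (auto simp: map_comp_Some_iff chart_inv_Some ran_def)
    have sparse: "infinite (\<Sigma> i - dom ?\<psi>)" "infinite (\<Sigma> i - ran ?\<psi>)" if "i < n" for i
      using x(3)[OF that] ydom(2)[OF that] dom ran
        finite_subset[of "\<Sigma> i - ran x" "\<Sigma> i - dom ?\<psi>"]
        finite_subset[of "\<Sigma> i - dom y" "\<Sigma> i - ran ?\<psi>"] by blast+
    obtain s1 s2 s3 where s: "s1 \<in> Stab X n \<Sigma>" "s2 \<in> Stab X n \<Sigma>" "s3 \<in> Stab X n \<Sigma>"
      "?\<psi> = s3 \<circ>\<^sub>m (k \<circ>\<^sub>m (s2 \<circ>\<^sub>m (h \<circ>\<^sub>m s1)))"
      using sparse_chart_factorization[OF \<psi>c c(2,4) sparse h(2,3,4) k'(2) krho] by metis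
    have "s1 \<in> T" "s2 \<in> T" "s3 \<in> T" using s Stab_subset by auto
    then have "?\<psi> \<in> T" unfolding s(4) by (intro T_comp h(1) k(1))
    \<comment> \<open>The cancellation rests on \<open>x\<close> being total and \<open>y\<close>
      being onto.\<close>
    moreover have "\<phi> = y \<circ>\<^sub>m (?\<psi> \<circ>\<^sub>m x)"
    proof (rule map_eqI_Some)
      fix a b
      have "(y \<circ>\<^sub>m (?\<psi> \<circ>\<^sub>m x)) a = Some b \<longleftrightarrow>
        (\<exists>a' a'' b' b''. x a = Some a' \<and> x a'' = Some a' \<and> \<phi> a'' = Some b'' \<and> y b' = Some b'' \<and> y b' = Some b)"
        using c by (auto simp: map_comp_Some_iff chart_inv_Some)
      also have "\<dots> \<longleftrightarrow> (\<exists>a' b'. x a = Some a' \<and> \<phi> a = Some b \<and> y b' = Some b)"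
        using charts_inj[OF c(1)] by (metis option.inject)
      also have "\<dots> \<longleftrightarrow> \<phi> a = Some b"
      proof
        assume ab: "\<phi> a = Some b"
        then have "a \<in> dom x" "b \<in> ran y" using charts_mem[OF \<phi>] x(2) ydom(1) by auto
        then show "\<exists>a' b'. x a = Some a' \<and> \<phi> a = Some b \<and> y b' = Some b"
          using ab by (auto simp: ran_def)
      qed blast
      finally show "\<phi> a = Some b \<longleftrightarrow> (y \<circ>\<^sub>m (?\<psi> \<circ>\<^sub>m x)) a = Some b" by simp
    qed
    ultimately show "\<phi> \<in> T" using T_comp x(1) y(1) by metis
  qed
qed

end

subsection \<open>Maximality and uniqueness\<close>

text \<open>If the product has cofinite domain, so does \<open>f\<close>, and hence \<open>f\<close>
  has cofinite range. Then \<open>g\<close> is undefined only at finitely many points outside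
  \<open>ran f\<close> and at images of the finitely many points lost by the product, so its domain
  and hence its range are cofinite. What the product misses is missed by \<open>g\<close> or is the
  image of a point missed by \<open>f\<close>.\<close>

lemma subsemigroup_cofinite_dom_ran:
  "subsemigroup {f \<in> charts X. infinite (X - dom f) \<or> finite (X - ran f)} (sym_inv_monoid X)"
    (is "subsemigroup ?M _")
  unfolding subsemigroup_sym_inv_monoid
proof (intro conjI ballI)
  fix f g assume f: "f \<in> ?M" and g: "g \<in> ?M"
  let ?D = "X - dom (g \<circ>\<^sub>m f)"
  have gX: "dom g \<subseteq> X" using g by (auto simp: charts_def)
  have fin: "finite (X - ran (g \<circ>\<^sub>m f))" if D: "finite ?D"
  proof -
    have "X - dom f \<subseteq> ?D" by (auto simp: map_comp_Some_iff)
    then have f': "finite (X - ran f)" using D f finite_subset by blast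
    have "X - dom g \<subseteq> (X - ran f) \<union> (\<lambda>x. the (f x)) ` ?D"
    proof
      fix y assume y: "y \<in> X - dom g"
      show "y \<in> (X - ran f) \<union> (\<lambda>x. the (f x)) ` ?D"
      proof (cases "y \<in> ran f")
        case True
        then obtain x where x: "f x = Some y" by (auto simp: ran_def)
        then have "x \<in> ?D" using y f charts_mem[of f X x y] by (auto simp: map_comp_Some_iff)
        then show ?thesis using x by (force intro: image_eqI[of _ _ x])
      qed (use y in blast)
    qed
    then have "finite (X - dom g)" using f' D finite_subset by blast
    then have g': "finite (X - ran g)" using g by blast
    have "X - ran (g \<circ>\<^sub>m f) \<subseteq> (X - ran g) \<union> (\<lambda>y. the (g y)) ` (X - ran f)"
    proof
      fix z assume z: "z \<in> X - ran (g \<circ>\<^sub>m f)"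
      show "z \<in> (X - ran g) \<union> (\<lambda>y. the (g y)) ` (X - ran f)"
      proof (cases "z \<in> ran g")
        case True
        then obtain y where y: "g y = Some z" by (auto simp: ran_def)
        moreover have "y \<in> X - ran f"
          using y z gX by (auto simp: ran_def map_comp_Some_iff)
        ultimately show ?thesis by (force intro: image_eqI[of _ _ y])
      qed (use z in blast)
    qed
    then show ?thesis using f' g' finite_subset by blast
  qed
  then show "g \<circ>\<^sub>m f \<in> ?M" using f g charts_comp[of f X g] by blast
qed blast

text \<open>If the product is total, then \<open>f\<close> is total, hence onto; so \<open>g\<close>
  is total on all of \<open>X\<close>, hence onto, and the product is onto.\<close>

lemma subsemigroup_partial_or_onto:
  "subsemigroup {f \<in> charts X. dom f \<noteq> X \<or> ran f = X} (sym_inv_monoid X)"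
    (is "subsemigroup ?M _")
  unfolding subsemigroup_sym_inv_monoid
proof (intro conjI ballI)
  fix f g assume f: "f \<in> ?M" and g: "g \<in> ?M"
  have comp: "g \<circ>\<^sub>m f \<in> charts X" using f g charts_comp[of f X g] by blast
  have "ran (g \<circ>\<^sub>m f) = X" if dom: "dom (g \<circ>\<^sub>m f) = X"
  proof -
    have "X \<subseteq> dom f" using dom by (auto simp: map_comp_Some_iff)
    then have "ran f = X" using f by (auto simp: charts_def)
    have "X \<subseteq> dom g"
    proof
      fix y assume "y \<in> X"
      then obtain x where x: "f x = Some y" using \<open>ran f = X\<close> by (auto simp: ran_def)
      then have "x \<in> dom (g \<circ>\<^sub>m f)" using dom f charts_mem[of f X x y] by blast
      then show "y \<in> dom g" using x by (auto simp: map_comp_Some_iff)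
    qed
    then have "ran g = X" using g by (auto simp: charts_def)
    have "X \<subseteq> ran (g \<circ>\<^sub>m f)"
    proof
      fix z assume "z \<in> X"
      then obtain y where y: "g y = Some z" using \<open>ran g = X\<close> by (auto simp: ran_def)
      then have "y \<in> ran f" using \<open>ran f = X\<close> g charts_mem[of g X y z] by blast
      then show "z \<in> ran (g \<circ>\<^sub>m f)" using y by (auto simp: ran_def map_comp_Some_iff)
    qed
    then show ?thesis using comp by (auto simp: charts_def)
  qed
  then show "g \<circ>\<^sub>m f \<in> ?M" using comp by blast
qed blast

section \<open>Witnesses, and maximality of the two semigroups\<close>

context infinite_partition
begin

text \<open>Each part is mapped injectively into itself with infinitely many points left over. The
  chart and its inverse serve as the total and the onto element in the proof of maximality.\<close>

lemma ex_total_coinfinite_id: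
  assumes "0 < n"
  obtains u where "u \<in> charts X" "dom u = X" "infinite (X - ran u)"
    "rho X n \<Sigma> u \<subseteq> {(i, id i) | i. i < n}"
proof -
  let ?B = "\<lambda>x. {z. \<exists>i<n. x \<in> \<Sigma> i \<and> z \<in> \<Sigma> i}"
  have B: "?B x = \<Sigma> i" if "i < n" "x \<in> \<Sigma> i" for i x
    using that part_unique by blast
  obtain t where t: "inj_on t X" "\<And>x. x \<in> X \<Longrightarrow> t x \<in> ?B x"
    "\<And>k. k \<in> {..<n} \<Longrightarrow> infinite (\<Sigma> k - t ` X)"
  proof (rule infinite_distinct_choice_sparse[OF countable, of "{..<n}" ?B \<Sigma>])
    fix x assume "x \<in> X"
    then obtain i where i: "i < n" "x \<in> \<Sigma> i" using part_ex by blast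
    show "infinite (?B x)" unfolding B[OF i] using infinite_part[OF i(1)] .
  qed (use infinite_part that in auto)
  have tX: "t x \<in> X" if "x \<in> X" for x using t(2)[OF that] part_subset by blast
  obtain u where u: "u \<in> charts X" "\<And>x y. u x = Some y \<longleftrightarrow> x \<in> X \<and> y = t x"
  proof (rule chart_of_relation[of "\<lambda>x y. x \<in> X \<and> y = t x" X])
    show "\<And>x y z. x \<in> X \<and> z = t x \<Longrightarrow> y \<in> X \<and> z = t y \<Longrightarrow> x = y"
      using t(1) by (auto simp: inj_on_def)
  qed (auto intro: that tX)
  have dom: "dom u = X" and ran: "ran u = t ` X" by (auto simp: dom_def ran_def u(2))
  show ?thesis
  proof
    show "u \<in> charts X" "dom u = X" using u dom by auto
    show "infinite (X - ran u)"
      using t(3)[of 0] assms part_subset[OF assms] ran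
        finite_subset[of "\<Sigma> 0 - t ` X" "X - ran u"] by blast
    show "rho X n \<Sigma> u \<subseteq> {(i, id i) | i. i < n}"
    proof (rule subrelI)
      fix i j assume "(i, j) \<in> rho X n \<Sigma> u"
      then have ij: "i < n" "j < n" "infinite {y \<in> \<Sigma> j. \<exists>x\<in>\<Sigma> i. u x = Some y}"
        using rho_iff[OF u(1)] by auto
      then obtain x y where xy: "y \<in> \<Sigma> j" "x \<in> \<Sigma> i" "u x = Some y"
        using infinite_imp_nonempty by blast
      then have "x \<in> X" "y = t x" using u(2) by auto
      then have "y \<in> \<Sigma> i" using t(2)[of x, unfolded B[OF ij(1) xy(2)]] by simp
      then have "i = j" using part_unique[OF ij(1,2) _ xy(1)] by simp
      then show "(i, j) \<in> {(i, id i) | i. i < n}" using ij(1) by simp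
    qed
  qed
qed

text \<open>A bijection from part 0 onto \<open>X\<close>, undefined elsewhere, has a full row 0 and
  an empty row 1. This separates the two semigroups.\<close>

lemma ex_A_part_not_A_part_inv:
  assumes "2 \<le> n"
  obtains f where "f \<in> A_part X n \<Sigma>" "f \<notin> A_part_inv X n \<Sigma>"
proof -
  have n: "0 < n" using assms by simp
  have "\<Sigma> 0 \<approx> X" using eqpoll_X_iff[OF n part_subset[OF n]] infinite_part[OF n] by blast
  then obtain t where t: "bij_betw t (\<Sigma> 0) X" by (auto simp: eqpoll_def)
  obtain f where f: "f \<in> charts X" "\<And>x y. f x = Some y \<longleftrightarrow> x \<in> \<Sigma> 0 \<and> y = t x"
  proof (rule chart_of_relation[of "\<lambda>x y. x \<in> \<Sigma> 0 \<and> y = t x" X])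
    show "\<And>x y. x \<in> \<Sigma> 0 \<and> y = t x \<Longrightarrow> x \<in> X \<and> y \<in> X"
      using part_subset[OF n] bij_betwE[OF t] by blast
    show "\<And>x y z. x \<in> \<Sigma> 0 \<and> z = t x \<Longrightarrow> y \<in> \<Sigma> 0 \<and> z = t y \<Longrightarrow> x = y"
      using t by (auto simp: bij_betw_def inj_on_def)
  qed (auto intro: that)
  have range: "(0, j) \<in> rho X n \<Sigma> f" if j: "j < n" for j
  proof -
    have "\<Sigma> j \<subseteq> t ` \<Sigma> 0" using t part_subset[OF j] by (simp add: bij_betw_def)
    then have "{y \<in> \<Sigma> j. \<exists>x\<in>\<Sigma> 0. f x = Some y} = \<Sigma> j" by (auto simp: f(2))
    then show ?thesis using rho_iff[OF f(1)] infinite_part[OF j] j n by simp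
  qed
  have "(1, j) \<notin> rho X n \<Sigma> f" for j
  proof
    assume "(1, j) \<in> rho X n \<Sigma> f"
    then have "infinite {y \<in> \<Sigma> j. \<exists>x\<in>\<Sigma> 1. f x = Some y}" using rho_iff[OF f(1)] by blast
    then obtain x where "x \<in> \<Sigma> 1" "x \<in> \<Sigma> 0"
      using infinite_imp_nonempty f(2) by blast
    then show False using part_unique[of 1 0 x] assms by simp
  qed
  then have dom: "1 \<notin> Domain (rho X n \<Sigma> f)" by blast
  have "\<not> perm_graph n (rho X n \<Sigma> f)"
  proof
    assume "perm_graph n (rho X n \<Sigma> f)"
    then obtain p where "rho X n \<Sigma> f = {(i, p i) | i. i < n}" by (auto simp: perm_graph_def)
    then have "(1, p 1) \<in> rho X n \<Sigma> f" using assms by simp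
    then show False using dom by blast
  qed
  moreover have "Range (rho X n \<Sigma> f) = {..<n}" using range rho_subset[of f] by blast
  ultimately have "f \<notin> A_part_inv X n \<Sigma>" by (simp add: A_part_inv_def)
  moreover have "f \<in> A_part X n \<Sigma>" using dom f(1) assms by (auto simp: A_part_def)
  ultimately show ?thesis using that by blast
qed

text \<open>A permutation can send infinitely many points of every part to every part. Its relation
  is then full, so it is total but relates 0 to both 0 and 1.\<close>

lemma ex_perm_not_A_part:
  assumes "2 \<le> n"
  obtains s where "s \<in> sym_perms X" "s \<notin> A_part X n \<Sigma>"
proof -
  have n: "0 < n" using assms by simp
  have "infinite X" using infinite_part[OF n] part_subset[OF n] finite_subset by blast
  \<comment> \<open>The stabiliser of the trivial partition is the whole symmetric group.\<close>
  then interpret triv: infinite_partition X 1 "\<lambda>_. X"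
    by unfold_locales (auto simp: countable disjoint_family_on_def)
  let ?C = "{..<n} \<times> {..<n}"
  obtain s where s: "s \<in> Stab X 1 (\<lambda>_. X)"
    "\<And>c. c \<in> ?C \<Longrightarrow> infinite {y \<in> \<Sigma> (snd c). \<exists>x\<in>\<Sigma> (fst c). s x = Some y}"
  proof (rule triv.Stab_infinite_meets[OF permutes_id, of ?C "\<lambda>_. 0" "\<lambda>c. \<Sigma> (fst c)" "\<lambda>c. \<Sigma> (snd c)"])
    show "countable ?C" by simp
  qed (use infinite_part that in \<open>auto intro: subsetD[OF part_subset]\<close>)
  have sc: "s \<in> charts X" using triv.Stab_charts[OF s(1)] .
  have full: "(i, j) \<in> rho X n \<Sigma> s" if "i < n" "j < n" for i j
    using s(2)[of "(i, j)"] that rho_iff[OF sc] by simp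
  have "\<not> perm_graph n (rho X n \<Sigma> s)"
  proof
    assume "perm_graph n (rho X n \<Sigma> s)"
    then obtain p where p: "rho X n \<Sigma> s = {(i, p i) | i. i < n}" by (auto simp: perm_graph_def)
    have "(0, 0) \<in> rho X n \<Sigma> s" "(0, 1) \<in> rho X n \<Sigma> s" using full assms by auto
    then show False unfolding p by auto
  qed
  moreover have "Domain (rho X n \<Sigma> s) = {..<n}" using full n rho_subset[of s] by blast
  ultimately have "s \<notin> A_part X n \<Sigma>" by (simp add: A_part_def)
  moreover have "s \<in> sym_perms X" using s(1) by (simp add: Stab_def)
  ultimately show ?thesis using that by blast
qed

lemma Stab_subset_A_part_inv: "Stab X n \<Sigma> \<subseteq> A_part_inv X n \<Sigma>"
proof
  fix s assume s: "s \<in> Stab X n \<Sigma>"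
  then have "chart_inv s \<in> A_part X n \<Sigma>" using Stab_inv Stab_subset_A_part by blast
  then show "s \<in> A_part_inv X n \<Sigma>"
    using inv_image_mem_iff[OF A_part_subset Stab_charts[OF s]] by (simp add: A_part_inv_eq)
qed

lemma sym_perms_not_subset:
  assumes "2 \<le> n"
  shows "\<not> sym_perms X \<subseteq> A_part X n \<Sigma>" "\<not> sym_perms X \<subseteq> A_part_inv X n \<Sigma>"
proof -
  obtain s where s: "s \<in> sym_perms X" "s \<notin> A_part X n \<Sigma>" using ex_perm_not_A_part[OF assms] .
  then show "\<not> sym_perms X \<subseteq> A_part X n \<Sigma>" by blast
  have sc: "s \<in> charts X" using s(1) by (simp add: sym_perms_def)
  then have "chart_inv s \<notin> A_part_inv X n \<Sigma>"
    using s(2) inv_image_mem_iff[OF A_part_subset chart_inv_charts[OF sc]] by (simp add: A_part_inv_eq)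
  then show "\<not> sym_perms X \<subseteq> A_part_inv X n \<Sigma>" using sym_perms_inv[OF s(1)] by blast
qed

text \<open>Of the elements required by \<open>eq_charts\<close>, only one outside
  \<open>A_part\<close> is missing from \<open>A_part\<close> itself, and any strictly larger
  subsemigroup supplies it.\<close>

lemma maximal_A_part:
  assumes "2 \<le> n"
  shows "maximal_subsemigroup (A_part X n \<Sigma>) (sym_inv_monoid X)"
  unfolding maximal_subsemigroup_def
proof (intro conjI allI impI)
  have sym: "sym_perms X \<subseteq> charts X" by (auto simp: sym_perms_def)
  show "subsemigroup (A_part X n \<Sigma>) (sym_inv_monoid X)" by (rule subsemigroup_A_part)
  show "A_part X n \<Sigma> \<noteq> carrier (sym_inv_monoid X)"
    using sym_perms_not_subset(1)[OF assms] sym by auto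
  fix T assume T: "subsemigroup T (sym_inv_monoid X) \<and> T \<noteq> carrier (sym_inv_monoid X)
    \<and> A_part X n \<Sigma> \<subseteq> T"
  then interpret Stab_subsemigroup X n \<Sigma> T
    using Stab_subset_A_part by unfold_locales auto
  show "T = A_part X n \<Sigma>"
  proof (rule ccontr)
    assume "T \<noteq> A_part X n \<Sigma>"
    then obtain f where f: "f \<in> T" "f \<notin> A_part X n \<Sigma>" using T by blast
    obtain g where g: "g \<in> A_part X n \<Sigma>" "g \<notin> A_part_inv X n \<Sigma>"
      using ex_A_part_not_A_part_inv[OF assms] .
    have n: "0 < n" using assms by simp
    obtain u where u: "u \<in> charts X" "dom u = X" "infinite (X - ran u)"
      "rho X n \<Sigma> u \<subseteq> {(i, id i) | i. i < n}"
      using ex_total_coinfinite_id[OF n] .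
    have uA: "u \<in> A_part X n \<Sigma>" using A_part_if_rho_subset[OF u(1) permutes_id u(4)] .
    have "rho X n \<Sigma> (chart_inv u) \<subseteq> {(i, id i) | i. i < n}" using u(4) by (auto simp: rho_inv[OF u(1)])
    then have vA: "chart_inv u \<in> A_part X n \<Sigma>"
      using A_part_if_rho_subset[OF chart_inv_charts[OF u(1)] permutes_id] by blast
    have "T = charts X"
      by (rule eq_charts[of u "chart_inv u" f g]) (use T f g u uA vA in auto)
    then show False using T by simp
  qed
qed

end

section \<open>Classification of the maximal subsemigroups\<close>

context Stab_subsemigroup
begin

text \<open>The finitely many gaps in \<open>dom u\<close> are removed one by one. If
  \<open>w\<close> is total and misses \<open>p\<close>, and \<open>s\<close> sends \<open>p\<close>
  to a gap \<open>y\<close> of \<open>u\<close>, then \<open>s\<close> after \<open>w\<close> never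
  reaches \<open>y\<close>, so \<open>u\<close> after them has fewer gaps, while its range stays
  inside \<open>ran u\<close>.\<close>

lemma ex_total_coinfinite:
  assumes w: "w \<in> T" "dom w = X" "ran w \<noteq> X"
    and u: "u \<in> T" "finite (X - dom u)" "infinite (X - ran u)"
  obtains f where "f \<in> T" "dom f = X" "infinite (X - ran f)"
proof -
  have wc: "w \<in> charts X" using w T_charts by blast
  obtain p where p: "p \<in> X" "p \<notin> ran w" using w(3) wc by (auto simp: charts_def)
  obtain i where i: "i < n" "p \<in> \<Sigma> i" using p part_ex by blast
  have "\<exists>f\<in>T. dom f = X \<and> infinite (X - ran f)"
    using u
  proof (induction "card (X - dom u)" arbitrary: u rule: less_induct)
    case less
    have uc: "u \<in> charts X" using less.prems T_charts by blast
    show ?case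
    proof (cases "dom u = X")
      case True
      then show ?thesis using less.prems by blast
    next
      case False
      then obtain y where y: "y \<in> X" "y \<notin> dom u" using uc by (auto simp: charts_def)
      obtain j where j: "j < n" "y \<in> \<Sigma> j" using y part_ex by blast
      have tr: "transpose i j permutes {..<n}" using i j by (intro permutes_swap_id) auto
      \<comment> \<open>Only one value of \<open>s\<close> is prescribed; exchanging indices
        \<open>i\<close> and \<open>j\<close> makes it compatible with the partition.\<close>
      obtain s where s: "s \<in> Stab X n \<Sigma>" "\<And>x z. [p \<mapsto> y] x = Some z \<Longrightarrow> s x = Some z"
      proof (rule extend_to_Stab[of "[p \<mapsto> y]", OF _ tr])
        show "[p \<mapsto> y] \<in> charts X" using p y by (auto simp: charts_iff split: if_splits)
        show "z \<in> \<Sigma> (transpose i j k)" if "k < n" "x \<in> \<Sigma> k" "[p \<mapsto> y] x = Some z" for k x z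
        proof -
          have "x = p" "z = y" using that(3) by (auto split: if_splits)
          then have "k = i" using part_unique[OF that(1) i(1)] that(2) i(2) by blast
          then show ?thesis using \<open>z = y\<close> j by simp
        qed
      qed (use infinite_part in \<open>auto intro: that\<close>)
      have sc: "s \<in> charts X" and sdom: "dom s = X" using s(1) Stab_charts Stab_dom by auto
      have sp: "s p = Some y" using s(2) by simp
      let ?g = "u \<circ>\<^sub>m (s \<circ>\<^sub>m w)"
      have swc: "s \<circ>\<^sub>m w \<in> charts X" using charts_comp[OF wc sc] .
      have swdom: "dom (s \<circ>\<^sub>m w) = X" using dom_total_comp[OF wc w(2) sdom] .
      \<comment> \<open>This map injects the gaps of the product into the gaps of \<open>u\<close>
        other than \<open>y\<close>.\<close>
      let ?e = "\<lambda>x. the ((s \<circ>\<^sub>m w) x)"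
      have inj: "inj_on ?e (X - dom ?g)"
      proof (rule inj_onI)
        fix a b assume ab: "a \<in> X - dom ?g" "b \<in> X - dom ?g" "?e a = ?e b"
        then have "a \<in> dom (s \<circ>\<^sub>m w)" "b \<in> dom (s \<circ>\<^sub>m w)" using swdom by auto
        then obtain c d where "(s \<circ>\<^sub>m w) a = Some c" "(s \<circ>\<^sub>m w) b = Some d" by blast
        then show "a = b" using ab(3) charts_inj[OF swc] by simp
      qed
      have im: "?e ` (X - dom ?g) \<subseteq> (X - dom u) - {y}"
      proof
        fix z assume "z \<in> ?e ` (X - dom ?g)"
        then obtain x where x: "x \<in> X - dom ?g" "z = ?e x" by blast
        then have "x \<in> dom (s \<circ>\<^sub>m w)" using swdom by blast
        then have xz: "(s \<circ>\<^sub>m w) x = Some z" using x(2) by auto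
        then have "z \<notin> dom u" using x(1) by (auto simp: map_comp_def)
        moreover have "z \<in> X" using charts_mem[OF swc xz] by blast
        moreover have "z \<noteq> y"
        proof
          assume "z = y"
          then obtain x' where "w x = Some x'" "s x' = Some y" using xz by (auto simp: map_comp_Some_iff)
          then show False using charts_inj[OF sc sp] p(2) by (auto simp: ran_def)
        qed
        ultimately show "z \<in> (X - dom u) - {y}" by blast
      qed
      have fin: "finite ((X - dom u) - {y})" using less.prems(2) by blast
      have "card (X - dom ?g) \<le> card ((X - dom u) - {y})" using card_inj_on_le[OF inj im fin] .
      also have "\<dots> < card (X - dom u)" using less.prems(2) y by (intro card_Diff1_less) auto
      finally have "card (X - dom ?g) < card (X - dom u)" .
      moreover have "?g \<in> T" using T_comp_Stab w(1) less.prems(1) s(1) by blast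
      moreover have "finite (X - dom ?g)" using inj_on_finite[OF inj im fin] .
      moreover have "infinite (X - ran ?g)"
        using less.prems(3) finite_subset[of "X - ran u" "X - ran ?g"] ran_comp_subset[of u "s \<circ>\<^sub>m w"]
        by blast
      ultimately show ?thesis using less.hyps by blast
    qed
  qed
  then show ?thesis using that by blast
qed

text \<open>One auxiliary semigroup yields an element with cofinite domain and infinite co-range,
  the other a total element that is not onto; \<open>ex_total_coinfinite\<close> combines
  them.\<close>

lemma maximal_ex_total_coinfinite:
  assumes "0 < n" and max: "maximal_subsemigroup T (sym_inv_monoid X)" and sym: "\<not> sym_perms X \<subseteq> T"
  obtains f where "f \<in> T" "dom f = X" "infinite (X - ran f)"
proof -
  \<comment> \<open>If \<open>T\<close> were contained in \<open>M\<close>, maximality would give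
    \<open>T = M\<close>, and \<open>T\<close> would contain all permutations.\<close>
  have escape: "\<exists>f\<in>T. f \<notin> M"
    if "subsemigroup M (sym_inv_monoid X)" "M \<noteq> charts X" "sym_perms X \<subseteq> M" for M
    using max that sym unfolding maximal_subsemigroup_def carrier_sym_inv_monoid by blast
  obtain u where u: "u \<in> charts X" "dom u = X" "infinite (X - ran u)"
    using ex_total_coinfinite_id[OF assms(1)] by metis
  have "\<exists>f\<in>T. f \<notin> {f \<in> charts X. infinite (X - dom f) \<or> finite (X - ran f)}"
  proof (rule escape[OF subsemigroup_cofinite_dom_ran])
    have "u \<notin> {f \<in> charts X. infinite (X - dom f) \<or> finite (X - ran f)}" using u by simp
    then show "{f \<in> charts X. infinite (X - dom f) \<or> finite (X - ran f)} \<noteq> charts X"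
      using u(1) by blast
    show "sym_perms X \<subseteq> {f \<in> charts X. infinite (X - dom f) \<or> finite (X - ran f)}"
      by (auto simp: sym_perms_def)
  qed
  then obtain v where v: "v \<in> T" "finite (X - dom v)" "infinite (X - ran v)" using T_charts by blast
  have "\<exists>f\<in>T. f \<notin> {f \<in> charts X. dom f \<noteq> X \<or> ran f = X}"
  proof (rule escape[OF subsemigroup_partial_or_onto])
    have "ran u \<noteq> X" using u(3) by auto
    then show "{f \<in> charts X. dom f \<noteq> X \<or> ran f = X} \<noteq> charts X"
      using u by blast
    show "sym_perms X \<subseteq> {f \<in> charts X. dom f \<noteq> X \<or> ran f = X}"
      by (auto simp: sym_perms_def)
  qed
  then obtain w where w: "w \<in> T" "dom w = X" "ran w \<noteq> X" using T_charts by blast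
  show ?thesis using ex_total_coinfinite[OF w v] that by blast
qed

text \<open>The preceding lemma and its dual supply \<open>u\<close> and \<open>v\<close>. As
  \<open>T\<close> is proper, \<open>eq_charts\<close> forces it into \<open>A_part\<close> or
  \<open>A_part_inv\<close>, which are proper subsemigroups, so maximality of \<open>T\<close> gives
  equality.\<close>

lemma maximal_eq_A_part:
  assumes n: "2 \<le> n" and max: "maximal_subsemigroup T (sym_inv_monoid X)"
    and sym: "\<not> sym_perms X \<subseteq> T"
  shows "T = A_part X n \<Sigma> \<or> T = A_part_inv X n \<Sigma>"
proof -
  have n': "0 < n" using n by simp
  have T: "T \<subseteq> charts X" using T_charts by blast
  have A: "maximal_subsemigroup (A_part X n \<Sigma>) (sym_inv_monoid X)" using maximal_A_part[OF n] .
  have Ainv: "maximal_subsemigroup (A_part_inv X n \<Sigma>) (sym_inv_monoid X)"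
    using maximal_subsemigroup_inv_image[OF A] by (simp add: A_part_inv_eq)
  have le: "T = M" if "T \<subseteq> M" "maximal_subsemigroup M (sym_inv_monoid X)" for M
    using that max unfolding maximal_subsemigroup_def by blast
  interpret inv: Stab_subsemigroup X n \<Sigma> "chart_inv ` T" by (rule Stab_subsemigroup_inv_image)
  obtain u where u: "u \<in> T" "dom u = X" "infinite (X - ran u)"
    using maximal_ex_total_coinfinite[OF n' max sym] .
  have "\<not> sym_perms X \<subseteq> chart_inv ` T"
  proof
    assume sub: "sym_perms X \<subseteq> chart_inv ` T"
    have "s \<in> T" if s: "s \<in> sym_perms X" for s
    proof -
      have sc: "s \<in> charts X" using s by (simp add: sym_perms_def)
      have "chart_inv s \<in> chart_inv ` T" using sym_perms_inv[OF s] sub by blast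
      then show ?thesis using inv_image_mem_iff[OF T chart_inv_charts[OF sc]] sc by simp
    qed
    then show False using sym by blast
  qed
  then obtain v' where v': "v' \<in> chart_inv ` T" "dom v' = X" "infinite (X - ran v')"
    using inv.maximal_ex_total_coinfinite[OF n' maximal_subsemigroup_inv_image[OF max]] by blast
  then obtain v where "v \<in> T" "v' = chart_inv v" by blast
  then have v: "v \<in> T" "ran v = X" "infinite (X - dom v)" using v' T_charts[of v] by auto
  have "T \<noteq> charts X" using max by (simp add: maximal_subsemigroup_def)
  then have "T \<subseteq> A_part X n \<Sigma> \<or> T \<subseteq> A_part_inv X n \<Sigma>" using eq_charts[OF u v] by blast
  then show ?thesis using le A Ainv by blast
qed

end

theorem theorem3p48:
  fixes X :: "'a set" and n :: nat and \<Sigma> :: "nat \<Rightarrow> 'a set"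
  assumes "countable X" and "infinite X"
    and "n \<ge> 2"
    and "indexed_partition X n \<Sigma>"
    and "\<And>i. i < n \<Longrightarrow> \<Sigma> i \<approx> X"
  shows "{S. maximal_subsemigroup S (sym_inv_monoid X) \<and> Stab X n \<Sigma> \<subseteq> S \<and> \<not> sym_perms X \<subseteq> S}
           = {A_part X n \<Sigma>, A_part_inv X n \<Sigma>}
         \<and> A_part X n \<Sigma> \<noteq> A_part_inv X n \<Sigma>"
proof -
  interpret infinite_partition X n \<Sigma>
  proof
    have P: "partition_on X (\<Sigma> ` {..<n})" "inj_on \<Sigma> {..<n}"
      using assms(4) by (auto simp: indexed_partition_def)
    show "countable X" by fact
    show "(\<Union>i<n. \<Sigma> i) = X" using partition_onD1[OF P(1)] by simp
    show "disjoint_family_on \<Sigma> {..<n}"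
      unfolding disjoint_family_on_def
      using disjointD[OF partition_onD2[OF P(1)]] inj_onD[OF P(2)] by (metis imageI)
    show "infinite (\<Sigma> i)" if "i < n" for i
      using eqpoll_finite_iff[OF assms(5)[OF that]] assms(2) by blast
  qed
  note n = assms(3)
  have max: "maximal_subsemigroup (A_part X n \<Sigma>) (sym_inv_monoid X)"
    "maximal_subsemigroup (A_part_inv X n \<Sigma>) (sym_inv_monoid X)"
    using maximal_A_part[OF n] maximal_subsemigroup_inv_image by (auto simp: A_part_inv_eq)
  have "S = A_part X n \<Sigma> \<or> S = A_part_inv X n \<Sigma>"
    if S: "maximal_subsemigroup S (sym_inv_monoid X)" "Stab X n \<Sigma> \<subseteq> S" "\<not> sym_perms X \<subseteq> S" for S
  proof -
    interpret Stab_subsemigroup X n \<Sigma> S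
      using S by unfold_locales (auto simp: maximal_subsemigroup_def)
    show ?thesis using maximal_eq_A_part[OF n S(1,3)] .
  qed
  moreover have "A_part X n \<Sigma> \<noteq> A_part_inv X n \<Sigma>"
    using ex_A_part_not_A_part_inv[OF n] by metis
  ultimately show ?thesis
    using max sym_perms_not_subset[OF n] Stab_subset_A_part Stab_subset_A_part_inv by blast
qed

end
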